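(* Let $r\ge 2$ and $k\ge r+2$ be integers, and let $n=pk+q$ with integers $p\ge 0$ and $0\le q<k$. Then for every $P_k$-free red-blue graph $G$ on $n$ vertices, $$g(G)\le p\binom{k}{r}+\begin{cases}\binom{q}{r} & \text{if } q\ge r+2,\\ \binom{q}{2} & \text{if } q\le r+2.\end{cases}$$ Furthermore, for every such $n$ there is a $P_k$-free red-blue graph on $n$ vertices attaining this bound.
   Context: $P_k$ denotes the path with $k$ edges. A red-blue graph is a (simple) graph each of whose edges is colored red or blue; it is $P_k$-free if its underlying uncolored graph contains no copy of $P_k$. For a red-blue graph $G$, let $G_r$ be the subgraph of red edges and $G_b$ the subgraph of blue edges, and define $g(G)=\mathcal{N}(K_r,G_b)+e(G_r)$, where $\mathcal{N}(K_r,G_b)$ is the number of copies of the complete graph $K_r$ in $G_b$ and $e(G_r)$ is the number of red edges. *)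

theory Defs
  imports "HOL-Library.Ramsey"
begin

datatype 'a graph = Graph (verts: "'a set") (edges: "'a set set")

definition simple_graph :: "'a graph \<Rightarrow> bool" where
  "simple_graph G \<longleftrightarrow> finite (verts G) \<and> edges G \<subseteq> [verts G]\<^bsup>2\<^esup>"

definition subgraph :: "'a graph \<Rightarrow> 'a graph \<Rightarrow> bool" where
  "subgraph H G \<longleftrightarrow> verts H \<subseteq> verts G \<and> edges H \<subseteq> edges G"

definition isomorphic :: "'b graph \<Rightarrow> 'a graph \<Rightarrow> bool" where
  "isomorphic H G \<longleftrightarrow>
    (\<exists>f. bij_betw f (verts H) (verts G) \<and> edges G = (\<lambda>e. f ` e) ` edges H)"

text \<open>Copies are subgraphs that need not be induced.\<close>

definition copies :: "'b graph \<Rightarrow> 'a graph \<Rightarrow> 'a graph set" where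
  "copies H G = {H'. subgraph H' G \<and> isomorphic H H'}"

definition num_copies :: "'b graph \<Rightarrow> 'a graph \<Rightarrow> nat" where
  "num_copies H G = card (copies H G)"

definition complete_graph :: "nat \<Rightarrow> nat graph" where
  "complete_graph r = Graph {..<r} ([{..<r}]\<^bsup>2\<^esup>)"

text \<open>The index of a path is its number of edges, so \<open>path_graph k\<close> has \<open>k + 1\<close> vertices.\<close>

definition path_graph :: "nat \<Rightarrow> nat graph" where
  "path_graph k = Graph {..k} {{i, Suc i} | i. i < k}"

definition path_free :: "nat \<Rightarrow> 'a graph \<Rightarrow> bool" where
  "path_free k G \<longleftrightarrow> copies (path_graph k) G = {}"

datatype colour = Red | Blue

text \<open>
  A red-blue graph is a simple graph \<open>G\<close> with a colouring \<open>c\<close> of its edges; the values of \<open>c\<close>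
  on sets that are not edges of \<open>G\<close> are irrelevant.
\<close>

definition colour_subgraph :: "'a graph \<Rightarrow> ('a set \<Rightarrow> colour) \<Rightarrow> colour \<Rightarrow> 'a graph" where
  "colour_subgraph G c x = Graph (verts G) {e \<in> edges G. c e = x}"

definition g :: "nat \<Rightarrow> 'a graph \<Rightarrow> ('a set \<Rightarrow> colour) \<Rightarrow> nat" where
  "g r G c = num_copies (complete_graph r) (colour_subgraph G c Blue)
             + card (edges (colour_subgraph G c Red))"

end

theory Submission
  imports Defs
begin

text \<open>
  The upper bound follows Kopylov's method. The bound \<open>F(n)\<close> is superadditive in \<open>n\<close> because the
  weight of a best coloured clique is convex in its size, so by induction one may assume that
  \<open>G\<close> is connected with \<open>n > k\<close>; colouring new edges red, one may also assume that \<open>G\<close> is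
  edge-maximal. Let \<open>t = (k - 1) div 2\<close>. If \<open>k\<close> vertices of degree at most \<open>t\<close> can be deleted
  successively, they cost at most as much as a clique of size \<open>k\<close>, and induction applies. Otherwise
  a core of minimum degree more than \<open>t\<close> remains. A component \<open>C\<close> of it has at most \<open>k\<close>
  vertices, since its longest path closes up to a cycle, and it is a clique by maximality. With
  \<open>a = k - |C|\<close>, maximality and connectedness show that all vertices outside \<open>C\<close> can be deleted
  successively with degree at most \<open>a\<close>, which bounds the weight by that of a clique of size
  \<open>k - a\<close> plus \<open>n - k + a\<close> vertices of degree \<open>a\<close>. Disjoint cliques attain the bound.
\<close>

section \<open>Convexity of the bound\<close>

text \<open>The largest weight of a red-blue clique on \<open>m\<close> vertices: all blue from
  \<open>r + 2\<close> on, all red below. At \<open>m = r + 2\<close> both colourings give the same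
  value.\<close>

definition clique_weight :: "nat \<Rightarrow> nat \<Rightarrow> nat" where
  "clique_weight r m = (if r + 2 \<le> m then m choose r else m choose 2)"

text \<open>Bounds the weight lost with a vertex of degree \<open>d\<close>: all its edges blue, one
  clique per \<open>(r - 1)\<close>-set of neighbours, or all red.\<close>

definition vertex_weight :: "nat \<Rightarrow> nat \<Rightarrow> nat" where
  "vertex_weight r d = max (d choose (r - 1)) d"

text \<open>The claimed bound as a function of the number of vertices: \<open>m div k\<close>
  optimal cliques of size \<open>k\<close> and one on the remainder.\<close>

definition path_bound :: "nat \<Rightarrow> nat \<Rightarrow> nat \<Rightarrow> nat" where
  "path_bound r k m = (m div k) * clique_weight r k + clique_weight r (m mod k)"

lemma le_binomial:
  assumes "1 \<le> j" "j < m"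
  shows "m \<le> m choose j"
  using assms
proof (induction m arbitrary: j)
  case (Suc m)
  show ?case
  proof (cases "j = m")
    case True
    then show ?thesis by simp
  next
    case False
    with Suc.prems have "m \<le> m choose j" "1 \<le> m choose (j - 1)"
      using Suc.IH by (auto simp: Suc_le_eq)
    moreover have "Suc m choose j = (m choose (j - 1)) + (m choose j)"
      using Suc.prems by (cases j) auto
    ultimately show ?thesis by simp
  qed
qed simp

text \<open>Discrete convexity: with nondecreasing differences \<open>d\<close>, a shift by
  \<open>s\<close> gains at least as much from \<open>j\<close> as from \<open>i\<close>. The sums
  are arranged to avoid truncated subtraction.\<close>

lemma convex_shift:
  fixes f d :: "nat \<Rightarrow> nat"
  assumes "\<And>m. f (Suc m) = f m + d m" and "mono d" and "i \<le> j"
  shows "f (i + s) + f j \<le> f (j + s) + f i"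
proof (induction s)
  case (Suc s)
  have "d (i + s) \<le> d (j + s)"
    using assms(2,3) by (auto intro: monoD)
  with Suc show ?case by (simp add: assms(1))
qed simp

lemma binomial_convex:
  assumes "1 \<le> j" "x \<le> y"
  shows "(x + s choose j) + (y choose j) \<le> (y + s choose j) + (x choose j)"
proof (rule convex_shift[OF _ _ assms(2)])
  show "Suc m choose j = (m choose j) + (m choose (j - 1))" for m
    using assms(1) by (cases j) auto
  show "mono (\<lambda>m. m choose (j - 1))"
    by (intro monoI binomial_right_mono)
qed

text \<open>The step from \<open>r + 1\<close> to \<open>r + 2\<close> still has the red increment,
  because (r+2 choose r) = (r+2 choose 2).\<close>

lemma clique_weight_Suc:
  assumes "2 \<le> r"
  shows "clique_weight r (Suc m) = clique_weight r m + (if r + 2 \<le> m then m choose (r - 1) else m)"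
proof -
  consider "r + 2 \<le> m" | "m = r + 1" | "m < r + 1" by linarith
  then show ?thesis
  proof cases
    case 1
    with assms show ?thesis by (cases r) (auto simp: clique_weight_def)
  next
    case 2
    have "(r + 2) choose r = (r + 2) choose 2"
      using binomial_symmetric[of r "r + 2"] by simp
    with 2 show ?thesis
      by (simp add: clique_weight_def numeral_2_eq_2)
  qed (auto simp: clique_weight_def numeral_2_eq_2)
qed

lemma clique_weight_convex:
  assumes "2 \<le> r" "i \<le> j"
  shows "clique_weight r (i + s) + clique_weight r j \<le> clique_weight r (j + s) + clique_weight r i"
proof (rule convex_shift[where f = "clique_weight r" and i = i and j = j, OF clique_weight_Suc[OF assms(1)] _ assms(2)])
  show "mono (\<lambda>m. if r + 2 \<le> m then m choose (r - 1) else m)"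
  proof (rule monoI)
    fix m n :: nat
    assume "m \<le> n"
    \<comment> \<open>The increments stay monotone across the switch of colour.\<close>
    moreover have "n \<le> n choose (r - 1)" if "r + 2 \<le> n"
      using le_binomial[of "r - 1" n] assms(1) that by simp
    ultimately show "(if r + 2 \<le> m then m choose (r - 1) else m) \<le> (if r + 2 \<le> n then n choose (r - 1) else n)"
      by (auto intro: binomial_right_mono)
  qed
qed

text \<open>Each increment of the clique weight is at least that of the number of pairs. This
  carries inequalities about pairs over to \<open>clique_weight\<close>.\<close>

lemma clique_weight_minus_pairs_mono:
  assumes "2 \<le> r"
  shows "clique_weight r i + (i + s choose 2) \<le> clique_weight r (i + s) + (i choose 2)"
proof (induction s)
  case (Suc s)
  have "i + s \<le> (i + s) choose (r - 1)" if "r + 2 \<le> i + s"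
    using le_binomial[of "r - 1" "i + s"] assms that by simp
  then show ?case
    using Suc clique_weight_Suc[OF assms, of "i + s"] by (auto simp: numeral_2_eq_2)
qed simp

lemma clique_weight_0 [simp]: "clique_weight r 0 = 0"
  by (simp add: clique_weight_def)

lemma binomial_2_le_clique_weight: "2 \<le> r \<Longrightarrow> m choose 2 \<le> clique_weight r m"
  using clique_weight_minus_pairs_mono[of r 0 m] by (simp add: numeral_2_eq_2)

lemma binomial_le_clique_weight:
  assumes "2 \<le> r"
  shows "m choose r \<le> clique_weight r m"
proof -
  consider "r + 2 \<le> m" | "m = r + 1" | "m = r" | "m < r" by linarith
  then show ?thesis
  proof cases
    case 2
    then have "m choose r = m"
      using binomial_symmetric[of r "r + 1"] by simp
    moreover have "m \<le> m choose 2"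
      using le_binomial[of 2 m] 2 assms by simp
    ultimately show ?thesis using 2 by (simp add: clique_weight_def)
  next
    case 3
    with assms show ?thesis by (simp add: clique_weight_def Suc_le_eq)
  qed (auto simp: clique_weight_def binomial_eq_0)
qed

lemma path_bound_eq: "q < k \<Longrightarrow> path_bound r k (p * k + q) = p * clique_weight r k + clique_weight r q"
  by (simp add: path_bound_def)

text \<open>Only the remainders matter. If their sum is below \<open>k\<close>, convexity merges the
  two cliques; otherwise it shifts vertices until one clique has size \<open>k\<close>.\<close>

lemma path_bound_superadditive:
  assumes "2 \<le> r" "0 < k"
  shows "path_bound r k a + path_bound r k b \<le> path_bound r k (a + b)"
proof -
  let ?w = "clique_weight r"
  let ?q = "a mod k" and ?q' = "b mod k" and ?p = "a div k + b div k"
  have q: "?q < k" "?q' < k" using assms by auto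
  have split: "a + b = ?p * k + (?q + ?q')"
    by (simp add: algebra_simps)
  have sum: "path_bound r k a + path_bound r k b = ?p * ?w k + (?w ?q + ?w ?q')"
    by (simp add: path_bound_def algebra_simps)
  show ?thesis
  proof (cases "?q + ?q' < k")
    case True
    then show ?thesis
      using clique_weight_convex[OF assms(1), of 0 ?q' ?q] path_bound_eq[OF True, of r ?p] split sum
      by (simp add: add.commute)
  next
    case False
    have "Suc ?p * k = ?p * k + k" by simp
    with False have s: "a + b = Suc ?p * k + (?q + ?q' - k)"
      using split by linarith
    moreover have "?q + ?q' - k < k"
      using q by linarith
    ultimately have "path_bound r k (a + b) = Suc ?p * ?w k + ?w (?q + ?q' - k)"
      by (metis path_bound_eq)
    moreover have "?w ?q + ?w ?q' \<le> ?w k + ?w (?q + ?q' - k)"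
    proof -
      have "?q + ?q' - k \<le> ?q'" "?q + ?q' - k + (k - ?q') = ?q" "?q' + (k - ?q') = k"
        using q False by linarith+
      then show ?thesis
        using clique_weight_convex[OF assms(1), of "?q + ?q' - k" ?q' "k - ?q'"] by simp
    qed
    ultimately show ?thesis
      using sum by simp
  qed
qed

section \<open>Binomial estimates for deleting vertices of small degree\<close>

lemma Suc_times_binomial_Suc: "Suc j * (n choose Suc j) = (n choose j) * (n - j)"
  by (metis binomial_absorb_comp binomial_absorption mult.commute)

text \<open>Compares the two falling products factor by factor: \<open>2 * (a - j)\<close> is at
  most \<open>2 * a - j\<close>.\<close>

lemma power2_binomial_le: "2 ^ j * (a choose j) \<le> 2 * a choose j"
proof (induction j)
  case (Suc j)
  have "Suc j * (2 ^ Suc j * (a choose Suc j)) = 2 ^ Suc j * (Suc j * (a choose Suc j))"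
    by (simp only: mult.left_commute)
  also have "\<dots> = (2 ^ j * (a choose j)) * (2 * a - 2 * j)"
    unfolding Suc_times_binomial_Suc by (simp add: diff_mult_distrib2)
  also have "\<dots> \<le> (2 * a choose j) * (2 * a - j)"
    using Suc by (intro mult_mono) auto
  also have "\<dots> = Suc j * (2 * a choose Suc j)"
    by (rule Suc_times_binomial_Suc[symmetric])
  finally show ?case by (simp del: binomial_Suc_Suc mult_Suc)
qed simp

text \<open>Since j (k choose j) = k (k-1 choose j-1), it suffices that j (a choose j-1) is at most
  (k-1 choose j-1). This follows from j \<le> 2^(j-1) and 2a \<le> k-1.\<close>

lemma peel_binomial:
  assumes "1 \<le> j" "2 * a + 1 \<le> k"
  shows "k * (a choose (j - 1)) \<le> k choose j"
proof -
  have "j \<le> 2 ^ (j - 1)"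
    using less_exp[of "j - 1"] by linarith
  then have "j * (a choose (j - 1)) \<le> 2 ^ (j - 1) * (a choose (j - 1))" by simp
  also have "\<dots> \<le> (k - 1) choose (j - 1)"
    using power2_binomial_le[of "j - 1" a] binomial_right_mono[of "2 * a" "k - 1" "j - 1"] assms(2) by linarith
  finally have "k * (j * (a choose (j - 1))) \<le> k * ((k - 1) choose (j - 1))" by simp
  also have "\<dots> = j * (k choose j)"
    using times_binomial_minus1_eq[of j k] assms by simp
  finally show ?thesis
    using assms(1) by simp
qed

text \<open>Deleting \<open>k\<close> vertices of degree at most \<open>a\<close> is paid for by one
  clique of size \<open>k\<close>. The two terms of the maximum are the cases \<open>j = r\<close>
  and \<open>j = 2\<close> of \<open>peel_binomial\<close>.\<close>

lemma peel_weight: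
  assumes "2 \<le> r" "r + 2 \<le> k" "2 * a + 1 \<le> k"
  shows "k * vertex_weight r a \<le> clique_weight r k"
proof -
  have "k * (a choose (r - 1)) \<le> clique_weight r k"
    using peel_binomial[of r a k] binomial_le_clique_weight[of r k] assms by linarith
  moreover have "k * a \<le> clique_weight r k"
    using peel_binomial[of 2 a k] binomial_2_le_clique_weight[of r k] assms by simp
  ultimately show ?thesis
    by (auto simp: vertex_weight_def max_def)
qed

text \<open>The convex function \<open>x choose j\<close> lies above the line through its value at
  \<open>a\<close> with slope \<open>a choose (j - 1)\<close>.\<close>

lemma binomial_tangent:
  assumes "1 \<le> j"
  shows "q * (a choose (j - 1)) + (a choose j) \<le> (q choose j) + a * (a choose (j - 1))"
proof (cases "a \<le> q")
  case True
  then show ?thesis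
  proof (induction q rule: dec_induct)
    case (step q)
    have "a choose (j - 1) \<le> q choose (j - 1)" using step by (intro binomial_right_mono)
    moreover have "Suc q choose j = (q choose (j - 1)) + (q choose j)" using assms by (cases j) auto
    ultimately show ?case using step by simp
  qed simp
next
  case False
  then have "q \<le> a" by simp
  then show ?thesis
  proof (induction q rule: inc_induct)
    case (step q)
    have "q choose (j - 1) \<le> a choose (j - 1)" using step by (intro binomial_right_mono) simp
    moreover have "Suc q choose j = (q choose (j - 1)) + (q choose j)" using assms by (cases j) auto
    ultimately show ?case using step by simp
  qed simp
qed

text \<open>Growing from \<open>k - a\<close> to \<open>k\<close> gains at least as much as growing
  from \<open>a + 1\<close> to \<open>2 * a + 1\<close>, and \<open>peel_binomial\<close> bounds a
  clique of size \<open>2 * a + 1\<close> from below. The tangent at \<open>a\<close> then replaces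
  \<open>a choose j\<close> by \<open>q choose j\<close>.\<close>

lemma core_binomial:
  assumes "1 \<le> j" "2 * a + 1 \<le> k"
  shows "(k - a choose j) + (a + q) * (a choose (j - 1)) \<le> (k choose j) + (q choose j)"
proof -
  have "(2 * a + 1 choose j) + (k - a choose j) \<le> (k choose j) + (a + 1 choose j)"
    using binomial_convex[OF assms(1), of "a + 1" "k - a" a] assms(2) by (simp add: mult_2)
  moreover have "(2 * a + 1) * (a choose (j - 1)) \<le> 2 * a + 1 choose j"
    using peel_binomial[of j a "2 * a + 1"] assms by simp
  moreover have "a + 1 choose j = (a choose (j - 1)) + (a choose j)"
    using assms(1) by (cases j) auto
  moreover have "(2 * a + 1) * (a choose (j - 1)) = a * (a choose (j - 1)) + a * (a choose (j - 1)) + (a choose (j - 1))"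
    "(a + q) * (a choose (j - 1)) = a * (a choose (j - 1)) + q * (a choose (j - 1))"
    by (simp_all add: add_mult_distrib)
  ultimately show ?thesis
    using binomial_tangent[OF assms(1), of q a] by linarith
qed

text \<open>The left side bounds a graph on \<open>k + q\<close> vertices that peels down to a
  clique of size \<open>k - a\<close>. Whichever term of \<open>vertex_weight\<close> dominates
  decides between counting pairs and counting \<open>r\<close>-sets.\<close>

lemma core_weight:
  assumes "2 \<le> r" "r + 2 \<le> k" "2 * a + 1 \<le> k"
  shows "clique_weight r (k - a) + (a + q) * vertex_weight r a \<le> clique_weight r k + clique_weight r q"
proof (cases "a choose (r - 1) \<le> a")
  case True
  have "clique_weight r (k - a) + (k choose 2) \<le> clique_weight r k + (k - a choose 2)"
    using clique_weight_minus_pairs_mono[OF assms(1), of "k - a" a] assms(3) by simp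
  moreover have "(k - a choose 2) + (a + q) * a \<le> (k choose 2) + (q choose 2)"
    using core_binomial[of 2 a k q] assms by simp
  ultimately show ?thesis
    using binomial_2_le_clique_weight[OF assms(1), of q] True by (simp add: vertex_weight_def)
next
  case False
  \<comment> \<open>For \<open>a\<close> at most \<open>r\<close> the binomial never exceeds
    \<open>a\<close>. Hence \<open>k - a\<close> and \<open>k\<close> both lie in the blue range of
    \<open>clique_weight\<close>.\<close>
  have "r + 1 \<le> a"
  proof (rule ccontr)
    assume "\<not> r + 1 \<le> a"
    then consider "a = r" | "a = r - 1" "0 < a" | "a < r - 1" using assms(1) by linarith
    then have "a choose (r - 1) \<le> a"
    proof cases
      case 1
      then show ?thesis using binomial_symmetric[of "r - 1" r] assms(1) by simp
    qed (auto simp: binomial_eq_0)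
    with False show False by simp
  qed
  then have "r + 2 \<le> k - a" using assms(3) by linarith
  then have "clique_weight r (k - a) = (k - a choose r)"
    by (simp add: clique_weight_def)
  moreover have "clique_weight r k = (k choose r)"
    using assms(2) by (simp add: clique_weight_def)
  moreover have "(k - a choose r) + (a + q) * (a choose (r - 1)) \<le> (k choose r) + (q choose r)"
    using core_binomial[of r a k q] assms by simp
  ultimately show ?thesis
    using binomial_le_clique_weight[OF assms(1), of q] False by (simp add: vertex_weight_def max_def)
qed

text \<open>For \<open>b\<close> blue and \<open>s\<close> red neighbours: if \<open>b\<close> is at
  least \<open>r - 2\<close>, turning a red neighbour blue creates at least one new clique, so all
  blue is best. Otherwise no blue clique contains the vertex and only red edges count.\<close>

lemma split_degree_weight:
  assumes "2 \<le> r" "b + s \<le> d"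
  shows "(b choose (r - 1)) + s \<le> vertex_weight r d"
proof (cases "r - 2 \<le> b")
  case True
  have "(b choose (r - 1)) + s \<le> (b + s) choose (r - 1)"
  proof (induction s)
    case (Suc s)
    obtain r' where "r = Suc (Suc r')"
      using assms(1) by (metis Suc_le_D numeral_2_eq_2 Suc_le_mono)
    then have "Suc (b + s) choose (r - 1) = ((b + s) choose (r - 2)) + ((b + s) choose (r - 1))"
      by simp
    moreover have "1 \<le> (b + s) choose (r - 2)"
      using True by (simp add: Suc_le_eq)
    ultimately show ?case using Suc by simp
  qed simp
  also have "\<dots> \<le> d choose (r - 1)"
    using assms(2) by (rule binomial_right_mono)
  finally show ?thesis by (simp add: vertex_weight_def)
next
  case False
  then have "b choose (r - 1) = 0" by (simp add: binomial_eq_0_iff)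
  with assms(2) have "(b choose (r - 1)) + s \<le> d" by linarith
  then show ?thesis by (simp add: vertex_weight_def)
qed

section \<open>Weights of red-blue graphs and peeling\<close>

definition blue_cliques :: "nat \<Rightarrow> 'a set set \<Rightarrow> ('a set \<Rightarrow> colour) \<Rightarrow> 'a set \<Rightarrow> 'a set set" where
  "blue_cliques r E c S = {K \<in> [S]\<^bsup>r\<^esup>. \<forall>e \<in> [K]\<^bsup>2\<^esup>. e \<in> E \<and> c e = Blue}"

definition red_edges :: "'a set set \<Rightarrow> ('a set \<Rightarrow> colour) \<Rightarrow> 'a set \<Rightarrow> 'a set set" where
  "red_edges E c S = {e \<in> [S]\<^bsup>2\<^esup>. e \<in> E \<and> c e = Red}"

text \<open>The quantity \<open>g\<close> of the subgraph induced on \<open>S\<close>.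
  \<open>E\<close> and \<open>c\<close> stay fixed while \<open>S\<close> shrinks, so
  \<open>E\<close> may contain pairs outside \<open>S\<close>.\<close>

definition graph_weight :: "nat \<Rightarrow> 'a set set \<Rightarrow> ('a set \<Rightarrow> colour) \<Rightarrow> 'a set \<Rightarrow> nat" where
  "graph_weight r E c S = card (blue_cliques r E c S) + card (red_edges E c S)"

definition nbrs :: "'a set set \<Rightarrow> 'a set \<Rightarrow> 'a \<Rightarrow> 'a set" where
  "nbrs E S x = {y \<in> S. y \<noteq> x \<and> {x, y} \<in> E}"

lemma finite_nbrs [simp]: "finite S \<Longrightarrow> finite (nbrs E S x)"
  by (simp add: nbrs_def)

lemma finite_blue_cliques [simp]: "finite S \<Longrightarrow> finite (blue_cliques r E c S)"
  by (simp add: blue_cliques_def finite_imp_finite_nsets)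

lemma finite_red_edges [simp]: "finite S \<Longrightarrow> finite (red_edges E c S)"
  by (simp add: red_edges_def finite_imp_finite_nsets)

lemma card_nsets_choose: "finite A \<Longrightarrow> card ([A]\<^bsup>j\<^esup>) = card A choose j"
proof -
  assume "finite A"
  then have "[A]\<^bsup>j\<^esup> = {B. B \<subseteq> A \<and> card B = j}"
    by (auto simp: nsets_def intro: finite_subset)
  then show ?thesis using n_subsets[OF \<open>finite A\<close>] by simp
qed

lemma card_double_count_le:
  assumes "finite A" "finite B"
    and "\<And>a. a \<in> A \<Longrightarrow> x \<le> card {b \<in> B. rel a b}"
    and "\<And>b. b \<in> B \<Longrightarrow> card {a \<in> A. rel a b} \<le> y"
  shows "card A * x \<le> card B * y"
proof -
  have "card A * x \<le> (\<Sum>a\<in>A. card {b \<in> B. rel a b})"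
    using sum_mono[of A "\<lambda>_. x"] assms(3) by simp
  also have "\<dots> = (\<Sum>b\<in>B. card {a \<in> A. rel a b})"
    using sum.swap_restrict[OF assms(1,2), of "\<lambda>_ _. 1::nat" rel] by simp
  also have "\<dots> \<le> card B * y"
    using sum_mono[of B _ "\<lambda>_. y"] assms(4) by simp
  finally show ?thesis .
qed

lemma card_nsets_superset:
  assumes "finite S" "e \<in> [S]\<^bsup>2\<^esup>" "2 \<le> r"
  shows "card {K \<in> [S]\<^bsup>r\<^esup>. e \<subseteq> K} = (card S - 2) choose (r - 2)"
proof -
  have e: "e \<subseteq> S" "finite e" "card e = 2" using assms(2) by (auto simp: nsets_def)
  have "bij_betw (\<lambda>L. L \<union> e) ([S - e]\<^bsup>(r - 2)\<^esup>) {K \<in> [S]\<^bsup>r\<^esup>. e \<subseteq> K}"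
  proof (rule bij_betw_byWitness[where f' = "\<lambda>K. K - e"])
    show "(\<lambda>L. L \<union> e) ` ([S - e]\<^bsup>(r - 2)\<^esup>) \<subseteq> {K \<in> [S]\<^bsup>r\<^esup>. e \<subseteq> K}"
    proof clarsimp
      fix L assume "L \<in> [S - e]\<^bsup>(r - 2)\<^esup>"
      moreover from this have "card (L \<union> e) = card L + card e"
        using e by (intro card_Un_disjoint) (auto simp: nsets_def)
      ultimately show "L \<union> e \<in> [S]\<^bsup>r\<^esup>"
        using e assms(3) by (auto simp: nsets_def)
    qed
    show "(\<lambda>K. K - e) ` {K \<in> [S]\<^bsup>r\<^esup>. e \<subseteq> K} \<subseteq> [S - e]\<^bsup>(r - 2)\<^esup>"
      using e by (auto simp: nsets_def card_Diff_subset)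
  qed (auto simp: nsets_def)
  then show ?thesis
    using card_nsets_choose[of "S - e" "r - 2"] assms(1) e
    by (simp add: bij_betw_same_card[symmetric] card_Diff_subset)
qed

lemma card_contained_pairs:
  assumes "K \<in> [S]\<^bsup>r\<^esup>" "A \<subseteq> [S]\<^bsup>2\<^esup>"
  shows "card {e \<in> A. e \<subseteq> K} \<le> r choose 2"
proof -
  have "finite K" "card K = r" using assms by (auto simp: nsets_def)
  then have "card {e \<in> A. e \<subseteq> K} \<le> card ([K]\<^bsup>2\<^esup>)"
    using assms by (intro card_mono) (auto simp: nsets_def)
  then show ?thesis using card_nsets_choose[of K 2] \<open>finite K\<close> \<open>card K = r\<close> by simp
qed

text \<open>Pairs (edge, \<open>r\<close>-set containing it) are counted twice. Above the threshold, the red edges are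
  outnumbered by the \<open>r\<close>-sets they spoil; below it, the blue cliques by the blue edges.\<close>

lemma graph_weight_le_clique_weight:
  assumes "finite S" "2 \<le> r"
  shows "graph_weight r E c S \<le> clique_weight r (card S)"
proof -
  let ?m = "card S" and ?R = "red_edges E c S" and ?Q = "blue_cliques r E c S"
  have pos: "0 < r choose 2" using assms(2) by simp
  \<comment> \<open>A pair lies in (m-2 choose r-2) of the \<open>r\<close>-sets, and an
    \<open>r\<close>-set contains (r choose 2) pairs. The two numbers agree at m = r + 2, which is
    why the threshold lies there.\<close>
  have sym: "r choose (r - 2) = r choose 2"
    using binomial_symmetric[OF assms(2)] by simp
  have fin: "finite ([S]\<^bsup>j\<^esup>)" for j using assms(1) by (rule finite_imp_finite_nsets)
  show ?thesis
  proof (cases "r + 2 \<le> ?m")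
    case True
    define D where "D = {K \<in> [S]\<^bsup>r\<^esup>. \<exists>e \<in> ?R. e \<subseteq> K}"
    have "card ?R * (r choose 2) \<le> card D * (r choose 2)"
    proof (rule card_double_count_le[where rel = "\<lambda>e K. e \<subseteq> K"])
      fix e assume e: "e \<in> ?R"
      then have "{K \<in> D. e \<subseteq> K} = {K \<in> [S]\<^bsup>r\<^esup>. e \<subseteq> K}" by (auto simp: D_def)
      moreover have "r choose (r - 2) \<le> (?m - 2) choose (r - 2)"
        using True by (intro binomial_right_mono) simp
      ultimately show "r choose 2 \<le> card {K \<in> D. e \<subseteq> K}"
        using card_nsets_superset[OF assms(1), of e r] e assms(2) sym by (simp add: red_edges_def)
    next
      fix K assume "K \<in> D"
      then show "card {e \<in> ?R. e \<subseteq> K} \<le> r choose 2"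
        by (intro card_contained_pairs[of K S]) (auto simp: D_def red_edges_def)
    qed (use assms fin in \<open>auto simp: D_def\<close>)
    then have "card ?R \<le> card D" using pos by simp
    moreover have "card ?Q + card D \<le> card ([S]\<^bsup>r\<^esup>)"
    proof -
      have "?Q \<inter> D = {}"
        by (fastforce simp: blue_cliques_def D_def red_edges_def nsets_def)
      then have "card ?Q + card D = card (?Q \<union> D)"
        using assms fin by (subst card_Un_disjoint) (auto simp: D_def)
      also have "\<dots> \<le> card ([S]\<^bsup>r\<^esup>)"
        using fin by (intro card_mono) (auto simp: D_def blue_cliques_def)
      finally show ?thesis .
    qed
    ultimately show ?thesis
      using True card_nsets_choose[OF assms(1), of r] by (simp add: graph_weight_def clique_weight_def)
  next
    case False
    define B where "B = {e \<in> [S]\<^bsup>2\<^esup>. e \<in> E \<and> c e = Blue}"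
    have "card ?Q * (r choose 2) \<le> card B * (r choose 2)"
    proof (rule card_double_count_le[where rel = "\<lambda>K e. e \<subseteq> K"])
      fix K assume K: "K \<in> ?Q"
      then have "{e \<in> B. e \<subseteq> K} = [K]\<^bsup>2\<^esup>"
        by (auto simp: B_def blue_cliques_def nsets_def)
      moreover have "finite K" "card K = r" using K by (auto simp: blue_cliques_def nsets_def)
      ultimately show "r choose 2 \<le> card {e \<in> B. e \<subseteq> K}"
        using card_nsets_choose[of K 2] by simp
    next
      fix e assume "e \<in> B"
      then have "card {K \<in> [S]\<^bsup>r\<^esup>. e \<subseteq> K} = (?m - 2) choose (r - 2)"
        using card_nsets_superset[OF assms(1), of e r] assms(2) by (simp add: B_def)
      also have "\<dots> \<le> r choose (r - 2)"
        using False by (intro binomial_right_mono) simp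
      finally have "card {K \<in> [S]\<^bsup>r\<^esup>. e \<subseteq> K} \<le> r choose 2" using sym by simp
      moreover have "card {K \<in> ?Q. e \<subseteq> K} \<le> card {K \<in> [S]\<^bsup>r\<^esup>. e \<subseteq> K}"
        using fin by (intro card_mono) (auto simp: blue_cliques_def)
      ultimately show "card {K \<in> ?Q. e \<subseteq> K} \<le> r choose 2" by simp
    qed (use assms fin in \<open>auto simp: B_def\<close>)
    then have "card ?Q \<le> card B" using pos by simp
    moreover have "card B + card ?R \<le> card ([S]\<^bsup>2\<^esup>)"
    proof -
      have "card B + card ?R = card (B \<union> ?R)"
        using assms fin by (subst card_Un_disjoint) (auto simp: B_def red_edges_def)
      also have "\<dots> \<le> card ([S]\<^bsup>2\<^esup>)"
        using fin by (intro card_mono) (auto simp: B_def red_edges_def)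
      finally show ?thesis .
    qed
    ultimately show ?thesis
      using False card_nsets_choose[OF assms(1), of 2] by (simp add: graph_weight_def clique_weight_def)
  qed
qed

text \<open>A clique cannot meet both sides of an edgeless cut. As every counted set is nonempty, it
  lies in exactly one side.\<close>

lemma graph_weight_Un:
  assumes "finite S" "finite T" "S \<inter> T = {}" "2 \<le> r"
    and no: "\<And>x y. x \<in> S \<Longrightarrow> y \<in> T \<Longrightarrow> {x, y} \<notin> E"
  shows "graph_weight r E c (S \<union> T) = graph_weight r E c S + graph_weight r E c T"
proof -
  have one_side: "A \<subseteq> S \<or> A \<subseteq> T" if "A \<subseteq> S \<union> T" "\<forall>e \<in> [A]\<^bsup>2\<^esup>. e \<in> E" for A
  proof (rule ccontr)
    assume "\<not> (A \<subseteq> S \<or> A \<subseteq> T)"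
    with that(1) obtain x y where "x \<in> A" "x \<in> S" "y \<in> A" "y \<in> T" by blast
    moreover from this have "{x, y} \<in> [A]\<^bsup>2\<^esup>" using assms(3) by auto
    ultimately show False using that(2) no by blast
  qed
  have sub: "A \<notin> [T]\<^bsup>j\<^esup>" if "A \<in> [S]\<^bsup>j\<^esup>" "2 \<le> j" for A j
  proof
    assume "A \<in> [T]\<^bsup>j\<^esup>"
    with that(1) have "A \<subseteq> S \<inter> T" "card A = j" by (auto simp: nsets_def)
    then show False using assms(3) that(2) by simp
  qed
  have "blue_cliques r E c (S \<union> T) = blue_cliques r E c S \<union> blue_cliques r E c T"
  proof (intro subset_antisym subsetI)
    fix K assume K: "K \<in> blue_cliques r E c (S \<union> T)"
    then have "K \<subseteq> S \<or> K \<subseteq> T"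
      by (intro one_side) (auto simp: blue_cliques_def nsets_def)
    with K show "K \<in> blue_cliques r E c S \<union> blue_cliques r E c T"
      by (auto simp: blue_cliques_def nsets_def)
  next
    fix K assume "K \<in> blue_cliques r E c S \<union> blue_cliques r E c T"
    then show "K \<in> blue_cliques r E c (S \<union> T)"
      unfolding blue_cliques_def using nsets_mono[of S "S \<union> T" r] nsets_mono[of T "S \<union> T" r] by blast
  qed
  moreover have "blue_cliques r E c S \<inter> blue_cliques r E c T = {}"
    using sub assms(4) by (auto simp: blue_cliques_def)
  moreover have "red_edges E c (S \<union> T) = red_edges E c S \<union> red_edges E c T"
  proof -
    have "e \<subseteq> S \<or> e \<subseteq> T" if "e \<in> [S \<union> T]\<^bsup>2\<^esup>" "e \<in> E" for e
      using one_side[of e] that by (auto elim!: nsets2_E)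
    then show ?thesis by (auto simp: red_edges_def nsets_def)
  qed
  moreover have "red_edges E c S \<inter> red_edges E c T = {}"
    using sub by (auto simp: red_edges_def)
  ultimately show ?thesis
    using assms(1,2) by (simp add: graph_weight_def card_Un_disjoint)
qed

text \<open>New blue cliques arise from \<open>(r - 1)\<close>-sets of blue neighbours of
  \<open>v\<close>, new red edges from its red neighbours.\<close>

lemma graph_weight_insert:
  assumes "finite S" "v \<notin> S" "2 \<le> r" "card (nbrs E S v) \<le> d"
  shows "graph_weight r E c (insert v S) \<le> graph_weight r E c S + vertex_weight r d"
proof -
  define Nb where "Nb = {u \<in> nbrs E S v. c {v, u} = Blue}"
  define Nr where "Nr = {u \<in> nbrs E S v. c {v, u} = Red}"
  have fin: "finite Nb" "finite Nr" using assms(1) by (auto simp: Nb_def Nr_def)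
  have "Nb \<inter> Nr = {}" "Nb \<union> Nr \<subseteq> nbrs E S v" by (auto simp: Nb_def Nr_def)
  then have deg: "card Nb + card Nr \<le> d"
    using card_mono[of "nbrs E S v" "Nb \<union> Nr"] assms(1,4) fin by (simp add: card_Un_disjoint)
  have "blue_cliques r E c (insert v S) \<subseteq> blue_cliques r E c S \<union> insert v ` ([Nb]\<^bsup>(r - 1)\<^esup>)"
  proof
    fix K assume K: "K \<in> blue_cliques r E c (insert v S)"
    show "K \<in> blue_cliques r E c S \<union> insert v ` ([Nb]\<^bsup>(r - 1)\<^esup>)"
    proof (cases "v \<in> K")
      case False
      then show ?thesis using K by (auto simp: blue_cliques_def nsets_def)
    next
      case True
      have "K - {v} \<subseteq> Nb"
      proof
        fix u assume "u \<in> K - {v}"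
        moreover from this have "{v, u} \<in> [K]\<^bsup>2\<^esup>" using True by auto
        ultimately show "u \<in> Nb"
          using K by (auto simp: blue_cliques_def Nb_def nbrs_def nsets_def)
      qed
      then have "K - {v} \<in> [Nb]\<^bsup>(r - 1)\<^esup>"
        using K True by (auto simp: blue_cliques_def nsets_def)
      moreover have "K = insert v (K - {v})" using True by auto
      ultimately show ?thesis by blast
    qed
  qed
  then have "card (blue_cliques r E c (insert v S)) \<le> card (blue_cliques r E c S \<union> insert v ` ([Nb]\<^bsup>(r - 1)\<^esup>))"
    using assms(1) fin by (intro card_mono) (auto intro: finite_imp_finite_nsets)
  also have "\<dots> \<le> card (blue_cliques r E c S) + (card Nb choose (r - 1))"
    using card_Un_le[of "blue_cliques r E c S"] card_image_le[of "[Nb]\<^bsup>(r - 1)\<^esup>" "insert v"]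
      card_nsets_choose[OF fin(1)] finite_imp_finite_nsets[OF fin(1)]
    by (metis (no_types, lifting) add_left_mono le_trans)
  finally have blue: "card (blue_cliques r E c (insert v S)) \<le> card (blue_cliques r E c S) + (card Nb choose (r - 1))" .
  have "red_edges E c (insert v S) \<subseteq> red_edges E c S \<union> (\<lambda>u. {v, u}) ` Nr"
    using assms(2) by (auto simp: red_edges_def Nr_def nbrs_def insert_commute elim!: nsets2_E)
  then have "card (red_edges E c (insert v S)) \<le> card (red_edges E c S \<union> (\<lambda>u. {v, u}) ` Nr)"
    using assms(1) fin by (intro card_mono) auto
  also have "\<dots> \<le> card (red_edges E c S) + card Nr"
    using card_Un_le[of "red_edges E c S"] card_image_le[OF fin(2), of "\<lambda>u. {v, u}"]
    by (metis (no_types, lifting) add_left_mono le_trans)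
  finally show ?thesis
    using blue split_degree_weight[OF assms(3) deg] by (simp add: graph_weight_def)
qed

text \<open>As \<open>e\<close> was not an edge, overriding its colour destroys no blue
  clique.\<close>

lemma graph_weight_add_red:
  assumes "finite S" "e \<notin> E"
  shows "graph_weight r E c S \<le> graph_weight r (insert e E) (c(e := Red)) S"
  unfolding graph_weight_def
proof (intro add_mono card_mono)
  show "blue_cliques r E c S \<subseteq> blue_cliques r (insert e E) (c(e := Red)) S"
    using assms(2) by (auto simp: blue_cliques_def)
  show "red_edges E c S \<subseteq> red_edges (insert e E) (c(e := Red)) S"
    by (auto simp: red_edges_def)
qed (use assms in auto)

section \<open>Cores left by successive deletion of vertices of small degree\<close>

text \<open>The \<open>(d + 1)\<close>-core of the graph on \<open>V\<close>: the largest vertex set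
  inducing minimum degree above \<open>d\<close>.\<close>

definition is_core :: "'a set set \<Rightarrow> nat \<Rightarrow> 'a set \<Rightarrow> 'a set \<Rightarrow> bool" where
  "is_core E d V H \<longleftrightarrow> H \<subseteq> V \<and> (\<forall>x \<in> H. d < card (nbrs E H x)) \<and>
    (\<forall>D \<subseteq> V. (\<forall>x \<in> D. d < card (nbrs E D x)) \<longrightarrow> D \<subseteq> H)"

lemma card_nbrs_mono: "S \<subseteq> T \<Longrightarrow> finite T \<Longrightarrow> card (nbrs E S x) \<le> card (nbrs E T x)"
  by (intro card_mono) (auto simp: nbrs_def)

text \<open>The union of all sets of minimum degree above \<open>d\<close> is one itself, since
  degrees only grow with the set.\<close>

lemma core_exists:
  assumes "finite V"
  shows "\<exists>H. is_core E d V H"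
proof -
  define good where "good D \<longleftrightarrow> D \<subseteq> V \<and> (\<forall>x \<in> D. d < card (nbrs E D x))" for D
  define H where "H = \<Union>(Collect good)"
  have sub: "D \<subseteq> H" if "good D" for D
    using that by (auto simp: H_def)
  have HV: "H \<subseteq> V" by (auto simp: H_def good_def)
  have "d < card (nbrs E H x)" if x: "x \<in> H" for x
  proof -
    obtain D where D: "good D" "x \<in> D" using x by (auto simp: H_def)
    have "d < card (nbrs E D x)" using D by (simp add: good_def)
    also have "\<dots> \<le> card (nbrs E H x)"
      using card_nbrs_mono[OF sub[OF D(1)]] finite_subset[OF HV assms] by simp
    finally show ?thesis .
  qed
  then have "is_core E d V H" using HV sub unfolding is_core_def good_def by simp
  then show ?thesis ..
qed

text \<open>As long as \<open>V\<close> exceeds \<open>H\<close>, maximality of the core yields a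
  vertex of degree at most \<open>d\<close>. It lies outside \<open>H\<close>, so \<open>H\<close>
  remains the core after its deletion, and \<open>graph_weight_insert\<close> bounds the
  loss.\<close>

lemma core_peel:
  assumes "finite V" "is_core E d V H" "2 \<le> r" "j \<le> card (V - H)"
  shows "\<exists>U. U \<subseteq> V \<and> H \<subseteq> U \<and> card U + j = card V \<and>
    graph_weight r E c V \<le> graph_weight r E c U + j * vertex_weight r d"
  using assms(1,2,4)
proof (induction j arbitrary: V)
  case 0
  then show ?case by (intro exI[of _ V]) (auto simp: is_core_def)
next
  case (Suc j)
  have HV: "H \<subseteq> V" using Suc.prems(2) by (simp add: is_core_def)
  have "V - H \<noteq> {}" using Suc.prems(3) by force
  then have "\<not> V \<subseteq> H" by blast
  then have "\<not> (\<forall>x \<in> V. d < card (nbrs E V x))"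
    using Suc.prems(2) unfolding is_core_def by blast
  then obtain x where x: "x \<in> V" "card (nbrs E V x) \<le> d" by (meson not_le)
  let ?V = "V - {x}"
  have "x \<notin> H"
    using card_nbrs_mono[OF HV Suc.prems(1), of E x] x(2) Suc.prems(2) unfolding is_core_def by fastforce
  then have core: "is_core E d ?V H" using Suc.prems(2) unfolding is_core_def by blast
  have "V - H = insert x (?V - H)" using x(1) \<open>x \<notin> H\<close> by auto
  then have "card (V - H) = Suc (card (?V - H))" using Suc.prems(1) by simp
  then have "j \<le> card (?V - H)" using Suc.prems(3) by simp
  then obtain U where U: "U \<subseteq> ?V" "H \<subseteq> U" "card U + j = card ?V"
    "graph_weight r E c ?V \<le> graph_weight r E c U + j * vertex_weight r d"
    using Suc.IH[OF _ core] Suc.prems(1) by blast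
  have "nbrs E ?V x = nbrs E V x" by (auto simp: nbrs_def)
  then have "graph_weight r E c V \<le> graph_weight r E c ?V + vertex_weight r d"
    using graph_weight_insert[of ?V x r E d c] Suc.prems x assms(3) by (simp add: insert_absorb)
  moreover have "card V = Suc (card ?V)"
    using x(1) Suc.prems(1) by (metis card_Suc_Diff1)
  ultimately show ?case using U by (intro exI[of _ U]) auto
qed

section \<open>Paths and cycles\<close>

text \<open>Paths are vertex lists over an arbitrary relation, so that the same notions serve the
  graph and its cone.\<close>

definition path_in :: "('b \<Rightarrow> 'b \<Rightarrow> bool) \<Rightarrow> 'b set \<Rightarrow> 'b list \<Rightarrow> bool" where
  "path_in R S xs \<longleftrightarrow> distinct xs \<and> set xs \<subseteq> S \<and> successively R xs"

text \<open>Degenerate cycles that run back and forth along one edge are allowed.\<close>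

definition cycle_in :: "('b \<Rightarrow> 'b \<Rightarrow> bool) \<Rightarrow> 'b set \<Rightarrow> 'b list \<Rightarrow> bool" where
  "cycle_in R S xs \<longleftrightarrow> path_in R S xs \<and> xs \<noteq> [] \<and> R (last xs) (hd xs)"

definition adj :: "'a set set \<Rightarrow> 'a \<Rightarrow> 'a \<Rightarrow> bool" where
  "adj E x y \<longleftrightarrow> {x, y} \<in> E"

text \<open>Connectedness in terms of cuts: a failing cut splits the weight additively, a holding
  one supplies a leaving edge.\<close>

definition cut_connected :: "'a set set \<Rightarrow> 'a set \<Rightarrow> bool" where
  "cut_connected E V \<longleftrightarrow> (\<forall>S. S \<subset> V \<longrightarrow> S \<noteq> {} \<longrightarrow> (\<exists>x\<in>S. \<exists>y\<in>V - S. {x, y} \<in> E))"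

lemma adj_sym: "adj E x y \<Longrightarrow> adj E y x"
  by (simp add: adj_def insert_commute)

lemma path_in_mono: "path_in R S xs \<Longrightarrow> S \<subseteq> T \<Longrightarrow> path_in R T xs"
  by (auto simp: path_in_def)

lemma path_in_rev:
  assumes "\<And>x y. R x y \<Longrightarrow> R y x" "path_in R S xs"
  shows "path_in R S (rev xs)"
  using assms(2) by (auto simp: path_in_def intro: successively_mono assms(1))

lemma path_in_append:
  "path_in R S (xs @ ys) \<longleftrightarrow> path_in R S xs \<and> path_in R S ys \<and> set xs \<inter> set ys = {} \<and>
     (xs = [] \<or> ys = [] \<or> R (last xs) (hd ys))"
  by (auto simp: path_in_def successively_append_iff)

lemma path_in_Cons:
  "path_in R S (x # xs) \<longleftrightarrow> x \<in> S \<and> x \<notin> set xs \<and> path_in R S xs \<and> (xs = [] \<or> R x (hd xs))"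
  by (auto simp: path_in_def successively_Cons)

lemma path_in_Nil [simp]: "path_in R S []"
  by (simp add: path_in_def)

lemma path_in_length: "path_in R S xs \<Longrightarrow> finite S \<Longrightarrow> length xs \<le> card S"
  by (metis path_in_def distinct_card card_mono)

lemma cycle_in_rotate:
  assumes "cycle_in R S cs" "x \<in> set cs"
  obtains xs where "cycle_in R S (x # xs)" "set (x # xs) = set cs" "length (x # xs) = length cs"
proof -
  obtain ys zs where cs: "cs = ys @ x # zs"
    using split_list[OF assms(2)] by blast
  show ?thesis
  proof (rule that[of "zs @ ys"])
    show "cycle_in R S (x # zs @ ys)"
      using assms(1) unfolding cs cycle_in_def path_in_append path_in_Cons
      by (cases ys; cases zs rule: rev_cases) (auto simp: path_in_append path_in_Cons hd_append)
  qed (auto simp: cs)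
qed

section \<open>Crossings on a path and the cycles they close\<close>

lemma card_le_index:
  assumes "A \<subseteq> f ` I" "finite I"
  shows "card A \<le> card I"
  using assms by (meson card_image_le card_mono finite_imageI le_trans)

text \<open>Elements of \<open>A\<close> are indexed by the position of their predecessor, which
  exists because the head is not in \<open>A\<close>. Thus \<open>A\<close> and \<open>B\<close> are
  both indexed by the first \<open>length P - 1\<close> positions.\<close>

lemma index_covers:
  assumes "A \<subseteq> set P" "P \<noteq> []" "hd P \<notin> A"
  shows "A \<subseteq> (\<lambda>i. P ! Suc i) ` {i. Suc i < length P \<and> P ! Suc i \<in> A}"
proof
  fix x assume "x \<in> A"
  then obtain i where i: "i < length P" "P ! i = x"
    using assms(1) by (metis in_set_conv_nth subsetD)
  have "i \<noteq> 0"
    using \<open>x \<in> A\<close> i assms(2,3) by (metis hd_conv_nth)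
  then show "x \<in> (\<lambda>i. P ! Suc i) ` {i. Suc i < length P \<and> P ! Suc i \<in> A}"
    using i \<open>x \<in> A\<close> by (intro image_eqI[of _ _ "i - 1"]) auto
qed

lemma index_covers_last:
  assumes "B \<subseteq> set P" "P \<noteq> []" "last P \<notin> B"
  shows "B \<subseteq> (\<lambda>i. P ! i) ` {i. Suc i < length P \<and> P ! i \<in> B}"
proof
  fix x assume "x \<in> B"
  then obtain i where i: "i < length P" "P ! i = x"
    using assms(1) by (metis in_set_conv_nth subsetD)
  have "i \<noteq> length P - 1"
    using \<open>x \<in> B\<close> i assms(2,3) by (metis last_conv_nth)
  then show "x \<in> (\<lambda>i. P ! i) ` {i. Suc i < length P \<and> P ! i \<in> B}"
    using i \<open>x \<in> B\<close> by (intro image_eqI[of _ _ i]) auto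
qed

text \<open>Pigeonhole: two index sets within \<open>length P - 1\<close> positions whose sizes add
  up to at least \<open>length P\<close> must meet.\<close>

lemma crossing_exists:
  assumes "A \<subseteq> set P" "B \<subseteq> set P" "P \<noteq> []" "hd P \<notin> A" "last P \<notin> B"
    and "length P \<le> card A + card B"
  shows "\<exists>i. Suc i < length P \<and> P ! Suc i \<in> A \<and> P ! i \<in> B"
proof (rule ccontr)
  let ?I = "{i. Suc i < length P \<and> P ! Suc i \<in> A}" and ?J = "{i. Suc i < length P \<and> P ! i \<in> B}"
  assume "\<not> ?thesis"
  then have "?I \<inter> ?J = {}" by auto
  moreover have fin: "finite ?I" "finite ?J"
    by (auto intro: finite_subset[of _ "{..<length P}"])
  ultimately have "card ?I + card ?J = card (?I \<union> ?J)" by (simp add: card_Un_disjoint)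
  also have "\<dots> \<le> card {..<length P - 1}" by (intro card_mono) auto
  finally have "card ?I + card ?J \<le> length P - 1" by simp
  moreover have "card A \<le> card ?I" "card B \<le> card ?J"
    using card_le_index index_covers[OF assms(1,3,4)] index_covers_last[OF assms(2,3,5)] fin by blast+
  moreover have "0 < length P" using assms(3) by simp
  ultimately show False using assms(6) by linarith
qed

text \<open>A crossing pair with \<open>b - a\<close> minimal is used: nothing strictly between \<open>a\<close> and \<open>b\<close> is in
  \<open>A\<close> or \<open>B\<close>, and unless \<open>b = a + 1\<close>, the predecessors of \<open>A\<close> avoid \<open>B\<close>.\<close>

lemma crossing_cycle:
  assumes sym: "\<And>x y. R x y \<Longrightarrow> R y x" and P: "path_in R S P" "P \<noteq> []"
    and A: "A \<subseteq> set P" "hd P \<notin> A" "\<And>x. x \<in> A \<Longrightarrow> R (hd P) x"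
    and B: "B \<subseteq> set P" "last P \<notin> B" "\<And>x. x \<in> B \<Longrightarrow> R (last P) x"
    and cross: "a0 < b0" "b0 < length P" "P ! b0 \<in> A" "P ! a0 \<in> B"
  shows "\<exists>cs. cycle_in R S cs \<and> set cs \<subseteq> set P \<and> A \<inter> B \<subseteq> set cs \<and> min (length P) (card A + card B) \<le> length cs"
proof -
  let ?N = "length P"
  define crossing where "crossing = (\<lambda>(a, b). a < b \<and> b < ?N \<and> P ! b \<in> A \<and> P ! a \<in> B)"
  have "crossing (a0, b0)" using cross by (simp add: crossing_def)
  then obtain ab where ab: "crossing ab" and least: "\<And>y. crossing y \<Longrightarrow> snd ab - fst ab \<le> snd y - fst y"
    using ex_has_least_nat[of crossing "(a0, b0)" "\<lambda>y. snd y - fst y"] by blast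
  obtain a b where [simp]: "ab = (a, b)" by (cases ab)
  have c: "a < b" "b < ?N" "P ! b \<in> A" "P ! a \<in> B" using ab by (auto simp: crossing_def)
  have min: "b - a \<le> y - x" if "x < y" "y < ?N" "P ! y \<in> A" "P ! x \<in> B" for x y
    using least[of "(x, y)"] that by (simp add: crossing_def)
  have gapA: "i \<le> a \<or> b \<le> i" if "i < ?N" "P ! i \<in> A" for i
    using min[of a i] that c by force
  have gapB: "i \<le> a \<or> b \<le> i" if "i < ?N" "P ! i \<in> B" for i
    using min[of i b] that c by force
  \<comment> \<open>Run from the head to position \<open>a\<close>, jump to the last vertex, run
    back to position \<open>b\<close> and close at the head.\<close>
  define cs where "cs = take (Suc a) P @ rev (drop b P)"
  have dist: "distinct P" "successively R P" using P by (auto simp: path_in_def)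
  have "path_in R S (take (Suc a) P @ drop (Suc a) P)" "path_in R S (take b P @ drop b P)"
    using P by simp_all
  then have pieces: "path_in R S (take (Suc a) P)" "path_in R S (rev (drop b P))"
    unfolding path_in_append using path_in_rev[of R, OF sym] by auto
  have "set (take (Suc a) P) \<inter> set (drop b P) = {}"
    using set_take_disj_set_drop_if_distinct[OF dist(1)] c by simp
  moreover have "last (take (Suc a) P) = P ! a" "hd (rev (drop b P)) = last P"
    using c by (auto simp: take_Suc_conv_app_nth hd_rev)
  moreover have "R (P ! a) (last P)" using B(3) c sym by blast
  ultimately have "path_in R S cs"
    using pieces by (simp add: cs_def path_in_append)
  moreover have "last cs = P ! b" "hd cs = hd P" "cs \<noteq> []"
    using c P by (auto simp: cs_def last_rev hd_drop_conv_nth)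
  moreover have "R (P ! b) (hd P)" using A(3) c sym by blast
  ultimately have "cycle_in R S cs" by (simp add: cycle_in_def)
  moreover have sub: "set cs \<subseteq> set P" by (auto simp: cs_def dest: in_set_takeD in_set_dropD)
  moreover have "A \<inter> B \<subseteq> set cs"
  proof
    fix z assume z: "z \<in> A \<inter> B"
    then obtain i where i: "i < ?N" "P ! i = z" using A(1) by (metis IntD1 in_set_conv_nth subsetD)
    then consider "i \<le> a" | "b \<le> i" using gapA z by blast
    then show "z \<in> set cs"
    proof cases
      case 1
      then have "z \<in> set (take (Suc a) P)"
        using i c by (auto simp: in_set_conv_nth intro!: exI[of _ i])
      then show ?thesis by (simp add: cs_def)
    next
      case 2
      then have "z \<in> set (drop b P)"
        using i c by (auto simp: in_set_conv_nth intro!: exI[of _ "i - b"])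
      then show ?thesis by (simp add: cs_def)
    qed
  qed
  moreover have len: "length cs = Suc a + (?N - b)" using c by (simp add: cs_def)
  moreover have "card A + card B \<le> length cs" if "b \<noteq> Suc a"
  proof -
    let ?I = "{i. Suc i < ?N \<and> P ! Suc i \<in> A}" and ?J = "{i. Suc i < ?N \<and> P ! i \<in> B}"
    have fin: "finite ?I" "finite ?J"
      by (auto intro: finite_subset[of _ "{..<?N}"])
    have "?I \<inter> ?J = {}"
    proof (rule ccontr)
      assume "?I \<inter> ?J \<noteq> {}"
      then obtain i where "Suc i < ?N" "P ! Suc i \<in> A" "P ! i \<in> B" by auto
      then show False using min[of i "Suc i"] c that by simp
    qed
    then have "card ?I + card ?J = card (?I \<union> ?J)" using fin by (simp add: card_Un_disjoint)
    \<comment> \<open>The two intervals have \<open>a + 1\<close> and \<open>?N - b\<close>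
      elements, together the length of \<open>cs\<close>.\<close>
    also have "?I \<union> ?J \<subseteq> {..a} \<union> {b - 1..<?N - 1}"
    proof
      fix i assume "i \<in> ?I \<union> ?J"
      then have "Suc i < ?N" "Suc i \<le> a \<or> b \<le> Suc i \<or> i \<le> a \<or> b \<le> i"
        using gapA[of "Suc i"] gapB[of i] by auto
      then show "i \<in> {..a} \<union> {b - 1..<?N - 1}" by auto
    qed
    then have "card (?I \<union> ?J) \<le> card ({..a} \<union> {b - 1..<?N - 1})"
      by (intro card_mono) auto
    also have "\<dots> \<le> card {..a} + card {b - 1..<?N - 1}" by (rule card_Un_le)
    also have "\<dots> = length cs" using len c by simp
    finally have "card ?I + card ?J \<le> length cs" .
    moreover have "card A \<le> card ?I" "card B \<le> card ?J"
      using card_le_index index_covers[OF A(1) P(2) A(2)] index_covers_last[OF B(1) P(2) B(2)] fin by blast+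
    ultimately show ?thesis by linarith
  qed
  ultimately show ?thesis
    using c by (intro exI[of _ cs]) (cases "b = Suc a"; auto)
qed

lemma ex_greatest_nat:
  assumes "Q x" "\<And>y. Q y \<Longrightarrow> f y \<le> (N :: nat)"
  obtains y where "Q y" "\<And>z. Q z \<Longrightarrow> f z \<le> f y"
proof -
  have "\<forall>y. Q y \<longrightarrow> f y < Suc N" using assms(2) by (simp add: less_Suc_eq_le)
  then show ?thesis using ex_has_greatest_nat[of Q x f "Suc N"] assms(1) that by auto
qed

text \<open>Dirac's argument: the ends of a longest path have all their neighbours on it, and their
  degrees add up to at least its length, so a cycle runs through all its vertices. An edge leaving
  the cycle would give a longer path, hence the cycle covers \<open>C\<close>.\<close>

lemma card_le_of_min_degree:
  assumes "finite C" "C \<noteq> {}" and conn: "cut_connected E C"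
    and deg: "\<And>x. x \<in> C \<Longrightarrow> t < card (nbrs E C x)" and "k \<le> 2 * t + 2"
    and pf: "\<And>xs. path_in (adj E) C xs \<Longrightarrow> length xs \<le> k"
  shows "card C \<le> k"
proof -
  obtain x0 where "x0 \<in> C" using assms(2) by blast
  then have "path_in (adj E) C [x0]" by (simp add: path_in_def)
  then obtain P where P: "path_in (adj E) C P" and max: "\<And>xs. path_in (adj E) C xs \<Longrightarrow> length xs \<le> length P"
    using ex_greatest_nat[of "path_in (adj E) C" "[x0]" length k] pf by blast
  have ne: "P \<noteq> []" using max[OF \<open>path_in (adj E) C [x0]\<close>] by auto
  have setP: "set P \<subseteq> C" using P by (simp add: path_in_def)
  have ends: "hd P \<in> C" "last P \<in> C" using setP ne by auto
  let ?A = "nbrs E C (hd P)" and ?B = "nbrs E C (last P)"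
  have A: "?A \<subseteq> set P"
  proof
    fix x assume x: "x \<in> ?A"
    show "x \<in> set P"
    proof (rule ccontr)
      assume "x \<notin> set P"
      then have "path_in (adj E) C (x # P)"
        using P x by (auto simp: path_in_Cons nbrs_def adj_def insert_commute)
      then show False using max by fastforce
    qed
  qed
  have B: "?B \<subseteq> set P"
  proof
    fix x assume x: "x \<in> ?B"
    show "x \<in> set P"
    proof (rule ccontr)
      assume "x \<notin> set P"
      then have "path_in (adj E) C (P @ [x])"
        using P x by (auto simp: path_in_append path_in_Cons nbrs_def adj_def)
      then show False using max by fastforce
    qed
  qed
  have big: "length P \<le> card ?A + card ?B"
    using deg[OF ends(1)] deg[OF ends(2)] pf[OF P] assms(5) by linarith
  have notin: "hd P \<notin> ?A" "last P \<notin> ?B" by (auto simp: nbrs_def)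
  obtain i where "Suc i < length P" "P ! Suc i \<in> ?A" "P ! i \<in> ?B"
    using crossing_exists[OF A B ne notin big] by blast
  moreover have "adj E (hd P) x" if "x \<in> ?A" for x using that by (simp add: nbrs_def adj_def)
  moreover have "adj E (last P) x" if "x \<in> ?B" for x using that by (simp add: nbrs_def adj_def)
  ultimately have "\<exists>cs. cycle_in (adj E) C cs \<and> set cs \<subseteq> set P \<and> ?A \<inter> ?B \<subseteq> set cs \<and>
      min (length P) (card ?A + card ?B) \<le> length cs"
    using crossing_cycle[OF adj_sym P ne A notin(1) _ B notin(2), of i "Suc i"] by blast
  then obtain cs where cs: "cycle_in (adj E) C cs" "set cs \<subseteq> set P" "length P \<le> length cs"
    using big by (auto simp: min_absorb1)
  have "distinct cs" "distinct P" using cs P by (auto simp: cycle_in_def path_in_def)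
  then have eq: "set cs = set P"
    using cs(2,3) by (metis List.finite_set card_seteq distinct_card)
  have "set P = C"
  proof (rule ccontr)
    assume "set P \<noteq> C"
    then have "set P \<subset> C" using setP by blast
    then obtain x y where xy: "x \<in> set P" "y \<in> C - set P" "{x, y} \<in> E"
      using conn ne unfolding cut_connected_def by (metis set_empty)
    obtain xs where xs: "cycle_in (adj E) C (x # xs)" "set (x # xs) = set cs" "length (x # xs) = length cs"
      using cycle_in_rotate[OF cs(1)] xy(1) eq by blast
    then have "path_in (adj E) C (y # x # xs)"
      using xy eq by (auto simp: path_in_Cons[of _ _ y] cycle_in_def adj_def insert_commute)
    then show False using max[of "y # x # xs"] xs(3) cs(3) by simp
  qed
  then show ?thesis using \<open>distinct P\<close> pf[OF P] by (metis distinct_card)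
qed

section \<open>Rerouting and joining paths\<close>

text \<open>The edge from the head to position \<open>J\<close> closes a cycle on the first
  \<open>J + 1\<close> vertices. From a position before \<open>J\<close> this cycle is run through
  entirely; from \<open>J\<close> on it suffices to walk back to the head.\<close>

lemma rotated_path:
  assumes sym: "\<And>x y. R x y \<Longrightarrow> R y x" and P: "path_in R S P" "J < length P" "R (hd P) (P ! J)" "m < length P"
  obtains ws where "path_in R S ws" "ws \<noteq> []" "hd ws = P ! m" "set ws \<subseteq> set P" "Suc J \<le> length ws"
proof (cases "J \<le> m")
  case True
  have "path_in R S (take (Suc m) P @ drop (Suc m) P)" using P by simp
  then have "path_in R S (rev (take (Suc m) P))"
    unfolding path_in_append using path_in_rev[of R, OF sym] by blast
  moreover have "hd (rev (take (Suc m) P)) = P ! m"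
    using P(4) by (simp add: hd_rev take_Suc_conv_app_nth)
  ultimately show ?thesis
    using that[of "rev (take (Suc m) P)"] True P set_take_subset[of "Suc m" P] by (cases P) auto
next
  case False
  define Q where "Q = drop (Suc m) (take (Suc J) P)"
  have split: "take (Suc J) P = take (Suc m) P @ Q"
    using append_take_drop_id[of "Suc m" "take (Suc J) P"] False by (simp add: Q_def min_def)
  have "path_in R S (take (Suc J) P @ drop (Suc J) P)" using P by simp
  then have "path_in R S (take (Suc m) P @ Q)" unfolding path_in_append split by blast
  then have "path_in R S (rev (take (Suc m) P))" "path_in R S (rev Q)" "set (take (Suc m) P) \<inter> set Q = {}"
    unfolding path_in_append using path_in_rev[of R, OF sym] by blast+
  moreover have "Q \<noteq> []" "last Q = P ! J"
    using False P by (auto simp: Q_def take_Suc_conv_app_nth)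
  moreover have "last (rev (take (Suc m) P)) = hd P" "hd (rev (take (Suc m) P)) = P ! m"
    using P(4) by (auto simp: last_rev hd_rev take_Suc_conv_app_nth hd_take hd_append hd_conv_nth)
  moreover have "rev (take (Suc m) P) \<noteq> []" using P(4) by auto
  ultimately have "path_in R S (rev (take (Suc m) P) @ rev Q)"
    "hd (rev (take (Suc m) P) @ rev Q) = P ! m" "rev (take (Suc m) P) @ rev Q \<noteq> []"
    using P(3) by (simp_all add: path_in_append hd_rev hd_append)
  moreover have "set (rev (take (Suc m) P) @ rev Q) \<subseteq> set P"
    using arg_cong[OF split, of set] set_take_subset[of "Suc J" P] by simp
  moreover have "Suc J \<le> length (rev (take (Suc m) P) @ rev Q)"
    using arg_cong[OF split, of length] P(2) by simp
  ultimately show ?thesis using that by blast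
qed

text \<open>\<open>S\<close> collects the ends of paths that start in \<open>C\<close> and
  afterwards avoid \<open>C\<close> and \<open>Y\<close>. An edge leaving \<open>S\<close> must lead
  into \<open>Y\<close>, since otherwise such a path, prolonged or cut short, would end at its far
  end.\<close>

lemma connecting_path:
  assumes conn: "cut_connected E V" and "C \<subseteq> V" "C \<noteq> {}" "Y \<subseteq> V" "Y \<noteq> {}" "C \<inter> Y = {}"
  obtains q y where "path_in (adj E) V q" "q \<noteq> []" "hd q \<in> C" "set (tl q) \<inter> (C \<union> Y) = {}"
    "y \<in> Y" "{last q, y} \<in> E"
proof -
  define good where "good q \<longleftrightarrow> path_in (adj E) V q \<and> q \<noteq> [] \<and> hd q \<in> C \<and> set (tl q) \<inter> (C \<union> Y) = {}" for q
  define S where "S = last ` {q. good q}"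
  have C: "C \<subseteq> S"
  proof
    fix x assume "x \<in> C"
    then have "good [x]" using assms by (auto simp: good_def path_in_def)
    then show "x \<in> S" unfolding S_def by force
  qed
  have SV: "S \<subseteq> V - Y"
  proof
    fix x assume "x \<in> S"
    then obtain q where "good q" "x = last q" by (auto simp: S_def)
    then show "x \<in> V - Y"
      using assms(6) by (cases q) (auto simp: good_def path_in_def dest: last_in_set)
  qed
  then obtain x w where xw: "x \<in> S" "w \<in> V" "w \<notin> S" "{x, w} \<in> E"
    using conn C assms(3,4,5) unfolding cut_connected_def
    by (metis (no_types, lifting) Diff_iff psubsetI subset_empty subset_iff ex_in_conv)
  obtain q where q: "good q" "last q = x" using xw(1) by (auto simp: S_def)
  have "w \<in> Y"
  proof (rule ccontr)
    assume w: "w \<notin> Y"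
    have "w \<notin> set q"
    proof
      assume "w \<in> set q"
      then obtain ys zs where "q = (ys @ [w]) @ zs" by (metis append.assoc append_Cons append_Nil split_list)
      moreover from this have "path_in (adj E) V (ys @ [w])"
        using q(1) by (simp add: good_def path_in_append[of _ _ "ys @ [w]"] del: append_assoc)
      ultimately have "good (ys @ [w])"
        using q(1) by (cases ys) (auto simp: good_def)
      then show False using xw(3) unfolding S_def by force
    qed
    then have "good (q @ [w])"
      using q xw w C by (auto simp: good_def path_in_append path_in_Cons adj_def)
    then show False using xw(3) unfolding S_def by force
  qed
  then show ?thesis using that[of q w] q xw by (simp add: good_def)
qed

lemma clique_path:
  assumes "finite C" "x \<in> C" "\<And>u v. u \<in> C \<Longrightarrow> v \<in> C \<Longrightarrow> u \<noteq> v \<Longrightarrow> {u, v} \<in> E"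
  obtains cs where "path_in (adj E) C cs" "set cs = C" "last cs = x" "cs \<noteq> []" "length cs = card C"
proof -
  obtain zs where zs: "set zs = C - {x}" "distinct zs"
    using finite_distinct_list[of "C - {x}"] assms(1) by blast
  let ?cs = "zs @ [x]"
  have "distinct ?cs" "set ?cs = C" using zs assms(2) by auto
  moreover from this have "successively (adj E) ?cs"
    unfolding successively_conv_nth adj_def
    by (metis Suc_lessD assms(3) n_not_Suc_n nth_eq_iff_index_eq nth_mem)
  ultimately show ?thesis
    using that[of ?cs] distinct_card[of ?cs] by (simp add: path_in_def)
qed

section \<open>Edge-maximal graphs\<close>

text \<open>\<open>P_k\<close>-freeness in terms of vertex lists: a path with \<open>k\<close> edges
  has \<open>k + 1\<close> vertices.\<close>

definition path_bounded :: "nat \<Rightarrow> 'a set set \<Rightarrow> 'a set \<Rightarrow> bool" where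
  "path_bounded k E V \<longleftrightarrow> (\<forall>xs. path_in (adj E) V xs \<longrightarrow> length xs \<le> k)"

definition path_maximal :: "nat \<Rightarrow> 'a set set \<Rightarrow> 'a set \<Rightarrow> bool" where
  "path_maximal k E V \<longleftrightarrow>
    (\<forall>u\<in>V. \<forall>v\<in>V. u \<noteq> v \<longrightarrow> {u, v} \<notin> E \<longrightarrow> \<not> path_bounded k (insert {u, v} E) V)"

text \<open>The cone adds a vertex \<open>None\<close> adjacent to every vertex. A cycle through \<open>None\<close> is the same as a
  path in the original graph, and a path completed by a missing edge \<open>uv\<close> is the same as a path
  from \<open>u\<close> to \<open>v\<close> through \<open>None\<close>.\<close>

fun cone :: "'a set set \<Rightarrow> 'a option \<Rightarrow> 'a option \<Rightarrow> bool" where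
  "cone E (Some x) (Some y) = ({x, y} \<in> E)"
| "cone E None None = False"
| "cone E None (Some y) = True"
| "cone E (Some x) None = True"

abbreviation cone_verts :: "'a set \<Rightarrow> 'a option set" where
  "cone_verts V \<equiv> insert None (Some ` V)"

text \<open>The \<open>k + 2\<close> vertices are \<open>None\<close> and the \<open>k + 1\<close>
  vertices of a path that is too long once \<open>x\<close> and \<open>y\<close> are joined.\<close>

definition cone_path :: "nat \<Rightarrow> 'a set set \<Rightarrow> 'a set \<Rightarrow> 'a \<Rightarrow> 'a \<Rightarrow> 'a option list \<Rightarrow> bool" where
  "cone_path k E V x y P \<longleftrightarrow> path_in (cone E) (cone_verts V) P \<and> P \<noteq> [] \<and> hd P = Some x \<and> last P = Some y \<and>
     None \<in> set P \<and> k + 2 \<le> length P"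

lemma cone_sym: "cone E a b \<Longrightarrow> cone E b a"
  by (cases a; cases b) (auto simp: insert_commute)

lemma path_in_map_Some [simp]: "path_in (cone E) (cone_verts V) (map Some xs) \<longleftrightarrow> path_in (adj E) V xs"
  by (auto simp: path_in_def successively_map distinct_map adj_def)

text \<open>Removing \<open>None\<close> from the cycle leaves a path of the original graph.\<close>

lemma cone_cycle_length:
  assumes "path_bounded k E V" "cycle_in (cone E) (cone_verts V) cs" "None \<in> set cs"
  shows "length cs \<le> k + 1"
proof -
  obtain xs where xs: "cycle_in (cone E) (cone_verts V) (None # xs)" "length (None # xs) = length cs"
    using cycle_in_rotate[OF assms(2,3)] by metis
  then have p: "path_in (cone E) (cone_verts V) xs" "None \<notin> set xs"
    by (auto simp: cycle_in_def path_in_Cons)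
  then obtain ys where "xs = map Some ys" by (metis ex_map_conv not_None_eq)
  then show ?thesis
    using p assms(1) xs(2) by (auto simp: path_bounded_def)
qed

lemma cone_path_sym: "cone_path k E V x y P \<Longrightarrow> cone_path k E V y x (rev P)"
  unfolding cone_path_def using path_in_rev[of "cone E", OF cone_sym]
  by (auto simp: hd_rev last_rev)

lemma cone_path_exists:
  assumes "path_bounded k E V" "path_maximal k E V" "u \<in> V" "v \<in> V" "u \<noteq> v" "{u, v} \<notin> E"
  shows "\<exists>P. cone_path k E V u v P"
proof -
  obtain xs where xs: "path_in (adj (insert {u, v} E)) V xs" "k < length xs"
    using assms(2-6) unfolding path_maximal_def path_bounded_def by (meson not_le)
  then have "\<not> path_in (adj E) V xs" using assms(1) by (auto simp: path_bounded_def)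
  with xs obtain i where i: "Suc i < length xs" "\<not> adj E (xs ! i) (xs ! Suc i)"
    by (auto simp: path_in_def successively_conv_nth)
  have d: "distinct xs" using xs by (simp add: path_in_def)
  have step: "adj (insert {u, v} E) (xs ! j) (xs ! Suc j)" if "Suc j < length xs" for j
    using xs(1) that by (auto simp: path_in_def successively_conv_nth)
  then have uv: "{xs ! i, xs ! Suc i} = {u, v}" using i by (auto simp: adj_def)
  have other: "adj E (xs ! j) (xs ! Suc j)" if "Suc j < length xs" "j \<noteq> i" for j
  proof -
    have "{xs ! j, xs ! Suc j} \<noteq> {xs ! i, xs ! Suc i}"
      using that i(1) d by (auto simp: doubleton_eq_iff nth_eq_iff_index_eq)
    then show ?thesis using step[OF that(1)] uv by (simp add: adj_def)
  qed
  let ?X = "take (Suc i) xs" and ?Y = "drop (Suc i) xs"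
  have "successively (adj E) ?X" "successively (adj E) ?Y"
    using other by (auto simp: successively_conv_nth)
  moreover have "set ?X \<subseteq> V" "set ?Y \<subseteq> V"
    using xs(1) set_take_subset set_drop_subset by (fastforce simp: path_in_def)+
  ultimately have "path_in (adj E) V ?X" "path_in (adj E) V ?Y"
    using d by (auto simp: path_in_def)
  then have "path_in (adj E) V (rev ?X)" "path_in (adj E) V (rev ?Y)"
    using path_in_rev[of "adj E", OF adj_sym] by blast+
  then have parts: "path_in (cone E) (cone_verts V) (map Some (rev ?X))"
    "path_in (cone E) (cone_verts V) (map Some (rev ?Y))" by (simp_all only: path_in_map_Some)
  \<comment> \<open>The overlong path uses the new edge between positions \<open>i\<close> and
    \<open>i + 1\<close>. Reversing both halves puts the ends of that edge outside, and
    \<open>None\<close> joins the former end vertices of the path.\<close>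
  define P where "P = map Some (rev ?X) @ None # map Some (rev ?Y)"
  have ne: "?X \<noteq> []" "?Y \<noteq> []" using i by auto
  have "set ?X \<inter> set ?Y = {}"
    using set_take_disj_set_drop_if_distinct[OF d] by simp
  moreover have "cone E (last (map Some (rev ?X))) None" "cone E None (hd (map Some (rev ?Y)))"
    using ne by (simp_all add: last_map hd_map)
  ultimately have "path_in (cone E) (cone_verts V) P"
    unfolding P_def path_in_append path_in_Cons using parts ne by auto
  moreover have "hd P = Some (xs ! i)"
    using ne i by (simp add: P_def hd_append hd_map hd_rev take_Suc_conv_app_nth)
  moreover have "last P = Some (xs ! Suc i)"
    using ne i by (simp add: P_def last_map last_rev hd_drop_conv_nth)
  moreover have "length P = Suc (length xs)" using i by (simp add: P_def)
  ultimately have "cone_path k E V (xs ! i) (xs ! Suc i) P"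
    using xs(2) by (auto simp: cone_path_def P_def)
  then show ?thesis
    using uv cone_path_sym by (metis doubleton_eq_iff)
qed

text \<open>The extremal choice ranges over all nonadjacent pairs from \<open>U\<close> and
  \<open>W\<close> together, so prolonging the path may change the pair.\<close>

lemma longest_cone_path:
  assumes "finite V" "path_bounded k E V" "path_maximal k E V" "U \<subseteq> V" "W \<subseteq> V"
    and "u \<in> U" "w \<in> W" "u \<noteq> w" "{u, w} \<notin> E"
  obtains x y P where "x \<in> U" "y \<in> W" "x \<noteq> y" "{x, y} \<notin> E" "cone_path k E V x y P"
    "\<And>x' y' P'. x' \<in> U \<Longrightarrow> y' \<in> W \<Longrightarrow> x' \<noteq> y' \<Longrightarrow> {x', y'} \<notin> E \<Longrightarrow> cone_path k E V x' y' P' \<Longrightarrow> length P' \<le> length P"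
proof -
  define Q where "Q P \<longleftrightarrow> (\<exists>x y. x \<in> U \<and> y \<in> W \<and> x \<noteq> y \<and> {x, y} \<notin> E \<and> cone_path k E V x y P)" for P
  obtain P0 where "Q P0"
    using cone_path_exists[OF assms(2,3), of u w] assms(4-) unfolding Q_def by blast
  moreover have "length P \<le> card (cone_verts V)" if "Q P" for P
    using that assms(1) path_in_length[of "cone E" "cone_verts V" P] unfolding Q_def cone_path_def by auto
  ultimately obtain P where P: "Q P" "\<And>z. Q z \<Longrightarrow> length z \<le> length P"
    using ex_greatest_nat[of Q P0 length] by blast
  show ?thesis
    using P(1) that P(2) unfolding Q_def by blast
qed

text \<open>If \<open>w\<close> were adjacent to \<open>y\<close>, the prolonged path would close to
  a cycle through \<open>None\<close> that is too long. Hence \<open>w\<close> and \<open>y\<close>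
  form another nonadjacent pair with a longer path.\<close>

lemma cone_path_extend:
  assumes "path_bounded k E V" "cone_path k E V x y P" "w \<in> V" "Some w \<notin> set P" "{x, w} \<in> E"
  shows "w \<noteq> y" "{w, y} \<notin> E" "cone_path k E V w y (Some w # P)"
proof -
  show "w \<noteq> y" using assms(2,4) by (auto simp: cone_path_def dest: last_in_set)
  show ext: "cone_path k E V w y (Some w # P)"
    using assms(2-) by (auto simp: cone_path_def path_in_Cons insert_commute)
  show "{w, y} \<notin> E"
  proof
    assume "{w, y} \<in> E"
    then have "cycle_in (cone E) (cone_verts V) (Some w # P)"
      using ext assms(2) by (auto simp: cone_path_def cycle_in_def insert_commute)
    then show False
      using cone_cycle_length[OF assms(1)] assms(2) by (fastforce simp: cone_path_def)
  qed
qed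

text \<open>In the cone both ends are also adjacent to \<open>None\<close>, so the neighbour sets
  have total size at least \<open>k + 2\<close>. A crossing would give a cycle of that length
  through the common neighbour \<open>None\<close>.\<close>

lemma cone_path_no_crossing:
  assumes "path_bounded k E V" and P: "cone_path k E V x y P"
    and A: "Some ` A \<subseteq> set P" "x \<notin> A" "\<And>w. w \<in> A \<Longrightarrow> {x, w} \<in> E"
    and B: "Some ` B \<subseteq> set P" "y \<notin> B" "\<And>w. w \<in> B \<Longrightarrow> {y, w} \<in> E"
    and "k \<le> card A + card B"
    and cross: "i < j" "j < length P" "P ! j \<in> cone_verts A" "P ! i \<in> cone_verts B"
  shows False
proof -
  have ends: "hd P = Some x" "last P = Some y" "P \<noteq> []" "None \<in> set P"
    using P by (auto simp: cone_path_def)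
  have fin: "finite A" "finite B"
    using A(1) B(1) by (meson List.finite_set finite_imageD finite_subset inj_Some inj_on_subset subset_UNIV)+
  have "\<exists>cs. cycle_in (cone E) (cone_verts V) cs \<and> set cs \<subseteq> set P \<and> cone_verts A \<inter> cone_verts B \<subseteq> set cs \<and>
      min (length P) (card (cone_verts A) + card (cone_verts B)) \<le> length cs"
  proof (rule crossing_cycle[OF cone_sym _ _ _ _ _ _ _ _ cross])
    show "path_in (cone E) (cone_verts V) P" using P by (simp add: cone_path_def)
  qed (use A B ends in auto)
  then obtain cs where cs: "cycle_in (cone E) (cone_verts V) cs" "None \<in> set cs"
    "min (length P) (card (cone_verts A) + card (cone_verts B)) \<le> length cs" by auto
  have "card (cone_verts A) = Suc (card A)" "card (cone_verts B) = Suc (card B)"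
    using fin by (auto simp: card_image card_insert_if)
  then have "k + 2 \<le> length cs"
    using cs(3) P assms(9) by (auto simp: cone_path_def)
  then show False using cone_cycle_length[OF assms(1) cs(1,2)] by simp
qed

section \<open>Cores in edge-maximal graphs\<close>

text \<open>For a nonadjacent pair with a longest cone path, all neighbours in \<open>C\<close> lie
  on the path. Their degree sum is at least \<open>k\<close>, hence above \<open>card C - 2\<close>,
  so they share a neighbour \<open>w\<close>. Both \<open>w\<close> and \<open>None\<close> are then
  adjacent to both ends and cross in either order.\<close>

lemma core_component_clique:
  assumes "finite V" "path_bounded k E V" "path_maximal k E V" "C \<subseteq> V" "card C \<le> k"
    and deg: "\<And>x. x \<in> C \<Longrightarrow> t < card (nbrs E C x)" and "k \<le> 2 * t + 2"
    and "u0 \<in> C" "v0 \<in> C" "u0 \<noteq> v0"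
  shows "{u0, v0} \<in> E"
proof (rule ccontr)
  assume "{u0, v0} \<notin> E"
  then obtain u v P where uv: "u \<in> C" "v \<in> C" "u \<noteq> v" "{u, v} \<notin> E" and P: "cone_path k E V u v P"
    and max: "\<And>x y P'. x \<in> C \<Longrightarrow> y \<in> C \<Longrightarrow> x \<noteq> y \<Longrightarrow> {x, y} \<notin> E \<Longrightarrow> cone_path k E V x y P' \<Longrightarrow> length P' \<le> length P"
    using longest_cone_path[of V k E C C u0 v0] assms by metis
  have inP: "Some ` nbrs E C x \<subseteq> set P'"
    if P': "cone_path k E V x y P'" "x \<in> C" "y \<in> C" "length P' = length P" for x y P'
  proof (rule image_subsetI, rule ccontr)
    fix w assume w: "w \<in> nbrs E C x" "Some w \<notin> set P'"
    then have "w \<in> C" "{x, w} \<in> E" by (auto simp: nbrs_def)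
    then show False
      using cone_path_extend[OF assms(2) P'(1), of w] w(2) assms(4) max[of w y "Some w # P'"] P'
      by auto
  qed
  have AP: "Some ` nbrs E C u \<subseteq> set P" using inP[OF P] uv by simp
  have BP: "Some ` nbrs E C v \<subseteq> set P" using inP[OF cone_path_sym[OF P]] uv by simp
  have finC: "finite C" using assms(1,4) finite_subset by blast
  have sum: "k \<le> card (nbrs E C u) + card (nbrs E C v)"
    using deg[OF uv(1)] deg[OF uv(2)] assms(7) by linarith
  have "nbrs E C u \<union> nbrs E C v \<subseteq> C - {u, v}"
    using uv by (auto simp: nbrs_def insert_commute)
  then have "card (nbrs E C u \<union> nbrs E C v) \<le> card (C - {u, v})"
    using finC by (intro card_mono) auto
  also have "\<dots> = card C - 2" using uv finC by (simp add: card_Diff_subset)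
  finally have "card (nbrs E C u \<union> nbrs E C v) \<le> card C - 2" .
  moreover have "0 < card C" "0 < card (nbrs E C u)"
    using uv finC deg[OF uv(1)] by (auto simp: card_gt_0_iff)
  moreover have "card (nbrs E C u \<union> nbrs E C v) + card (nbrs E C u \<inter> nbrs E C v) = card (nbrs E C u) + card (nbrs E C v)"
    using card_Un_Int[of "nbrs E C u" "nbrs E C v"] finC by simp
  ultimately have "card (nbrs E C u \<inter> nbrs E C v) \<noteq> 0"
    using sum assms(5) by linarith
  then obtain w where w: "w \<in> nbrs E C u" "w \<in> nbrs E C v" by (metis Int_iff card.empty all_not_in_conv)
  then have "Some w \<in> set P" "None \<in> set P" using AP P by (auto simp: cone_path_def)
  then obtain i j where ij: "i < length P" "P ! i = Some w" "j < length P" "P ! j = None"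
    by (metis in_set_conv_nth)
  have nocross: False if "i < j" "j < length P" "P ! j \<in> cone_verts (nbrs E C u)" "P ! i \<in> cone_verts (nbrs E C v)" for i j
    by (rule cone_path_no_crossing[OF assms(2) P AP _ _ BP _ _ sum that]) (auto simp: nbrs_def)
  have "i \<noteq> j" using ij by auto
  then show False
    using nocross[of i j] nocross[of j i] ij w by (metis imageI insertCI nat_neq_iff)
qed

text \<open>As \<open>C\<close> is a clique of size \<open>k - a\<close>, the degrees of \<open>x \<in> C\<close> and \<open>y \<in> H - C\<close> add up to enough
  for the crossing argument. If nothing crosses, \<open>None\<close> separates \<open>C\<close> from the neighbours of
  \<open>y\<close>, and connectedness joins the two pieces to a path that is too long.\<close>

lemma outer_core_eq:
  assumes "finite V" "path_bounded k E V" "path_maximal k E V" "cut_connected E V"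
    and "C \<subseteq> H" "H \<subseteq> V" "C \<noteq> {}" "card C + a = k"
    and clique: "\<And>u v. u \<in> C \<Longrightarrow> v \<in> C \<Longrightarrow> u \<noteq> v \<Longrightarrow> {u, v} \<in> E"
    and deg: "\<And>x. x \<in> H \<Longrightarrow> a < card (nbrs E H x)"
    and nonfull: "\<And>y. y \<in> H - C \<Longrightarrow> \<exists>x\<in>C. {x, y} \<notin> E"
  shows "H = C"
proof (rule ccontr)
  assume "H \<noteq> C"
  then obtain y0 where y0: "y0 \<in> H - C" using assms(5) by blast
  then obtain x0 where x0: "x0 \<in> C" "{x0, y0} \<notin> E" using nonfull by blast
  have CV: "C \<subseteq> V" and WV: "H - C \<subseteq> V" using assms(5,6) by auto
  have ne0: "x0 \<noteq> y0" using x0 y0 by auto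
  obtain x y P where xy: "x \<in> C" "y \<in> H - C" "x \<noteq> y" "{x, y} \<notin> E" and P: "cone_path k E V x y P"
    and max: "\<And>x' y' P'. x' \<in> C \<Longrightarrow> y' \<in> H - C \<Longrightarrow> x' \<noteq> y' \<Longrightarrow> {x', y'} \<notin> E \<Longrightarrow> cone_path k E V x' y' P' \<Longrightarrow> length P' \<le> length P"
    using longest_cone_path[OF assms(1-3) CV WV x0(1) y0 ne0 x0(2)] by metis
  have CP: "Some ` (C - {x}) \<subseteq> set P"
  proof (rule image_subsetI, rule ccontr)
    fix w assume w: "w \<in> C - {x}" "Some w \<notin> set P"
    then have "{x, w} \<in> E" "w \<in> V" using clique[of x w] xy CV by auto
    from cone_path_extend[OF assms(2) P this(2) w(2) this(1)] show False
      using max[of w y "Some w # P"] w xy by auto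
  qed
  have xP: "Some x \<in> set P" "Some y \<in> set P" and hdP: "hd P = Some x" "last P = Some y" "P \<noteq> []"
    using P by (auto simp: cone_path_def) (metis hd_in_set, metis last_in_set)
  have BP: "Some ` nbrs E H y \<subseteq> set P"
  proof (rule image_subsetI, rule ccontr)
    fix w assume w: "w \<in> nbrs E H y" "Some w \<notin> set P"
    then have w': "w \<in> H - C" "{y, w} \<in> E" "w \<in> V" using CP xP assms(6) by (auto simp: nbrs_def)
    have "Some w \<notin> set (rev P)" using w by simp
    from cone_path_extend[OF assms(2) cone_path_sym[OF P] w'(3) this w'(2)]
    show False
      using max[of x w "rev (Some w # rev P)"] cone_path_sym w' xy by (fastforce simp: insert_commute)
  qed
  have finC: "finite C" using CV assms(1) finite_subset by blast
  have sum: "k \<le> card (C - {x}) + card (nbrs E H y)"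
    using deg[of y] xy finC assms(8) by (simp add: card_Diff_singleton_if) 
  have nocross: False if "i < j" "j < length P" "P ! j \<in> cone_verts (C - {x})" "P ! i \<in> cone_verts (nbrs E H y)" for i j
  proof (rule cone_path_no_crossing[OF assms(2) P CP _ _ BP _ _ sum that])
    show "{x, w} \<in> E" if "w \<in> C - {x}" for w using clique[of x w] that xy by auto
  qed (auto simp: nbrs_def)
  have "None \<in> set P" using P by (simp add: cone_path_def)
  then obtain P1 P2 where split: "P = P1 @ None # P2" by (meson split_list)
  have dP: "distinct P" "path_in (cone E) (cone_verts V) P" using P by (auto simp: cone_path_def path_in_def)
  \<comment> \<open>\<open>None\<close> is adjacent to both ends: a vertex of \<open>C - {x}\<close>
    after it, or a neighbour of \<open>y\<close> before it, would give a crossing.\<close>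
  have C1: "Some ` C \<subseteq> set P1"
  proof (rule image_subsetI)
    fix w assume w: "w \<in> C"
    show "Some w \<in> set P1"
    proof (cases "w = x")
      case True
      then show ?thesis using hdP split by (cases P1) auto
    next
      case False
      show ?thesis
      proof (rule ccontr)
        assume "Some w \<notin> set P1"
        moreover have "Some w \<in> set P" using CP w False by auto
        ultimately have "Some w \<in> set P2" using split by auto
        then obtain j where j: "j < length P2" "P2 ! j = Some w" by (auto simp: in_set_conv_nth)
        then show False
          using nocross[of "length P1" "length P1 + Suc j"] w False by (auto simp: split nth_append)
      qed
    qed
  qed
  have B2: "Some ` nbrs E H y \<subseteq> set P2"
  proof (rule image_subsetI, rule ccontr)
    fix w assume w: "w \<in> nbrs E H y" "Some w \<notin> set P2"
    then have "Some w \<in> set P1" using BP split by auto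
    then obtain j where j: "j < length P1" "P1 ! j = Some w" by (auto simp: in_set_conv_nth)
    then show False
      using nocross[of j "length P1"] w by (auto simp: split nth_append)
  qed
  have "None \<notin> set P2" using dP split by auto
  then obtain zs where zs: "P2 = map Some zs" by (metis ex_map_conv not_None_eq)
  \<comment> \<open>The part after \<open>None\<close>, reversed so that it starts at
    \<open>y\<close>.\<close>
  define ys where "ys = rev zs"
  have "path_in (cone E) (cone_verts V) P2" using dP(2) unfolding split path_in_append path_in_Cons by blast
  then have ysp: "path_in (adj E) V ys"
    unfolding zs ys_def path_in_map_Some using path_in_rev[of "adj E", OF adj_sym] by blast
  have "zs \<noteq> []" using hdP split zs by auto
  then have ysne: "ys \<noteq> []" and hdys: "hd ys = y" using hdP split zs by (auto simp: ys_def hd_rev last_map)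
  have Bys: "nbrs E H y \<subseteq> set ys" using B2 by (auto simp: zs ys_def)
  have Cys: "C \<inter> set ys = {}"
    using C1 dP(1) by (auto simp: split zs ys_def)
  define I where "I = {j. j < length ys \<and> ys ! j \<in> nbrs E H y}"
  have finI: "finite I" by (simp add: I_def)
  have "nbrs E H y \<subseteq> (!) ys ` I"
    using Bys by (force simp: I_def in_set_conv_nth)
  then have cI: "card (nbrs E H y) \<le> card I" using finI by (rule card_le_index)
  have aB: "a < card (nbrs E H y)" using deg xy by auto
  then have "I \<noteq> {}" using cI by auto
  \<comment> \<open>The farthest neighbour of \<open>y\<close> on \<open>ys\<close>. At least
    \<open>a + 1\<close> neighbours occupy positions 1 to \<open>J\<close>, so \<open>J\<close>
    exceeds \<open>a\<close>.\<close>
  define J where "J = Max I"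
  have J: "J \<in> I" unfolding J_def using finI \<open>I \<noteq> {}\<close> by (rule Max_in)
  have "0 \<notin> I" using hdys ysne by (auto simp: I_def nbrs_def hd_conv_nth)
  then have "I \<subseteq> {1..J}"
    using finI unfolding J_def by (metis Max_ge atLeastAtMost_iff less_one not_le subsetI)
  then have "card I \<le> J" using card_mono[of "{1..J}" I] by simp
  then have aJ: "a < J" using aB cI by linarith
  have "set ys \<subseteq> V" using ysp by (simp add: path_in_def)
  moreover have "set ys \<noteq> {}" using ysne by simp
  ultimately obtain q v where q: "path_in (adj E) V q" "q \<noteq> []" "hd q \<in> C" "set (tl q) \<inter> (C \<union> set ys) = {}"
    "v \<in> set ys" "{last q, v} \<in> E"
    using connecting_path[OF assms(4) CV assms(7) _ _ Cys] by metis
  obtain m where m: "m < length ys" "ys ! m = v" using q(5) by (auto simp: in_set_conv_nth)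
  have J': "J < length ys" "adj E (hd ys) (ys ! J)" using J hdys by (auto simp: I_def nbrs_def adj_def)
  obtain ws where ws: "path_in (adj E) V ws" "ws \<noteq> []" "hd ws = v" "set ws \<subseteq> set ys" "Suc J \<le> length ws"
    using rotated_path[OF adj_sym ysp J' m(1)] m(2) by metis
  obtain cs where cs: "path_in (adj E) C cs" "set cs = C" "last cs = hd q" "cs \<noteq> []" "length cs = card C"
    using clique_path[of C "hd q" E] finC q(3) clique by blast
  have "path_in (adj E) V (hd q # tl q)" using q by simp
  then have "path_in (adj E) V (cs @ tl q)"
    using path_in_mono[OF cs(1) CV] cs q(4) unfolding path_in_append path_in_Cons by auto
  moreover have "last (cs @ tl q) = last q"
    using cs q(2) by (cases q) auto
  \<comment> \<open>All of \<open>C\<close>, then the connection, then at least \<open>J + 1\<close>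
    vertices of \<open>ys\<close>: more than \<open>(k - a) + a\<close> vertices.\<close>
  ultimately have "path_in (adj E) V ((cs @ tl q) @ ws)"
    using ws cs(2) q(4,6) Cys unfolding path_in_append[of _ _ "cs @ tl q"] by (auto simp: adj_def)
  then have "length ((cs @ tl q) @ ws) \<le> k" using assms(2) unfolding path_bounded_def by blast
  then show False using cs(5) ws(5) aJ assms(8) by simp
qed

section \<open>The upper bound\<close>

lemma graph_weight_le_maximal:
  assumes "finite V" and r: "2 \<le> r" and k: "r + 2 \<le> k"
    and pf: "path_bounded k E V" and maxl: "path_maximal k E V"
    and IH: "\<And>U. U \<subset> V \<Longrightarrow> graph_weight r E c U \<le> path_bound r k (card U)"
  shows "graph_weight r E c V \<le> path_bound r k (card V)"
proof (cases "card V \<le> k")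
  case True
  have "path_bound r k (card V) = clique_weight r (card V)"
    using True by (cases "card V = k") (use k in \<open>simp_all add: path_bound_def\<close>)
  then show ?thesis using graph_weight_le_clique_weight[OF assms(1) r] by simp
next
  case big: False
  let ?w = "graph_weight r E c" and ?F = "path_bound r k"
  have k0: "0 < k" using k by simp
  \<comment> \<open>Adding \<open>k\<close> vertices raises the bound by at least a whole clique of
    size \<open>k\<close>, which pays for \<open>k\<close> cheap deletions.\<close>
  have peel: "?w V \<le> ?F (card V)"
    if U: "U \<subseteq> V" "card U + k = card V" "?w V \<le> ?w U + k * vertex_weight r d" "2 * d + 1 \<le> k" for U d
  proof -
    have "U \<subset> V" using U k0 by auto
    then have "?w V \<le> ?F (card U) + clique_weight r k"
      using IH[of U] U(3) peel_weight[OF r k U(4)] by linarith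
    also have "clique_weight r k = ?F k" using k0 by (simp add: path_bound_def)
    also have "?F (card U) + ?F k \<le> ?F (card V)"
      using path_bound_superadditive[OF r k0, of "card U" k] U(2) by simp
    finally show ?thesis .
  qed
  show ?thesis
  proof (cases "cut_connected E V")
    case False
    then obtain S where S: "S \<subset> V" "S \<noteq> {}" "\<And>x y. x \<in> S \<Longrightarrow> y \<in> V - S \<Longrightarrow> {x, y} \<notin> E"
      unfolding cut_connected_def by blast
    have fin: "finite S" "finite (V - S)" using S assms(1) finite_subset by auto
    have VS: "V = S \<union> (V - S)" and cS: "card V = card S + card (V - S)"
      using S(1) assms(1) by (auto simp: card_Diff_subset fin card_mono)
    have "?w V = ?w S + ?w (V - S)"
      using graph_weight_Un[OF fin _ r S(3)] VS by simp
    also have "\<dots> \<le> ?F (card S) + ?F (card (V - S))"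
      using IH[of S] IH[of "V - S"] S by (intro add_mono) auto
    also have "\<dots> \<le> ?F (card V)"
      using path_bound_superadditive[OF r k0] cS by simp
    finally show ?thesis .
  next
    case conn: True
    \<comment> \<open>The lower bound on \<open>k\<close> makes deletions at degree \<open>t\<close>
      affordable; the upper bound makes two degrees above \<open>t\<close> add up to at least
      \<open>k\<close>.\<close>
    define t where "t = (k - 1) div 2"
    have t: "2 * t + 1 \<le> k" "k \<le> 2 * t + 2" using k0 by (auto simp: t_def)
    obtain H where H: "is_core E t V H" using core_exists[OF assms(1)] by blast
    then have HV: "H \<subseteq> V" and Hdeg: "\<And>x. x \<in> H \<Longrightarrow> t < card (nbrs E H x)"
      and Hmax: "\<And>D. D \<subseteq> V \<Longrightarrow> \<forall>x\<in>D. t < card (nbrs E D x) \<Longrightarrow> D \<subseteq> H"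
      by (simp_all add: is_core_def)
    note Hpeel = core_peel[OF assms(1) H r, where c = c]
    show ?thesis
    proof (cases "k \<le> card (V - H)")
      case True
      then obtain U where "U \<subseteq> V" "card U + k = card V" "?w V \<le> ?w U + k * vertex_weight r t"
        using Hpeel by blast
      then show ?thesis using peel t(1) by blast
    next
      case False
      have finH: "finite H" using HV assms(1) finite_subset by blast
      \<comment> \<open>A smallest closed set is a component of the core; its minimality gives
        connectedness.\<close>
      define closed where "closed S \<longleftrightarrow> S \<subseteq> H \<and> S \<noteq> {} \<and> (\<forall>x\<in>S. \<forall>y\<in>H - S. {x, y} \<notin> E)" for S
      have "H \<noteq> {}" using False big by auto
      then have "closed H" by (simp add: closed_def)
      then obtain C where C: "closed C" and least: "\<And>S. closed S \<Longrightarrow> card C \<le> card S"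
        using ex_has_least_nat[of closed H card] by blast
      have CH: "C \<subseteq> H" "C \<noteq> {}" and Cclosed: "\<And>x y. x \<in> C \<Longrightarrow> y \<in> H \<Longrightarrow> {x, y} \<in> E \<Longrightarrow> y \<in> C"
        using C unfolding closed_def by auto
      have CV: "C \<subseteq> V" and finC: "finite C" using CH HV finH finite_subset by auto
      have connC: "cut_connected E C"
        unfolding cut_connected_def
      proof (intro allI impI)
        fix S assume S: "S \<subset> C" "S \<noteq> {}"
        then have "\<not> closed S" using least psubset_card_mono[OF finC S(1)] by fastforce
        then show "\<exists>x\<in>S. \<exists>y\<in>C - S. {x, y} \<in> E"
          using S CH Cclosed unfolding closed_def by blast
      qed
      have degC: "t < card (nbrs E C x)" if "x \<in> C" for x
      proof -
        have "nbrs E C x = nbrs E H x" using CH Cclosed that by (auto simp: nbrs_def)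
        then show ?thesis using Hdeg CH that by auto
      qed
      have cardC: "card C \<le> k"
        using card_le_of_min_degree[OF finC CH(2) connC degC t(2)] pf path_in_mono[OF _ CV]
        unfolding path_bounded_def by blast
      have clique: "{u, v} \<in> E" if "u \<in> C" "v \<in> C" "u \<noteq> v" for u v
        using core_component_clique[OF assms(1) pf maxl CV cardC degC t(2) that] .
      have "C \<subset> V" using CV big cardC by auto
      then obtain x1 y1 where xy1: "x1 \<in> C" "y1 \<in> V - C" "{x1, y1} \<in> E"
        using conn CH(2) unfolding cut_connected_def by blast
      \<comment> \<open>A clique on \<open>k\<close> vertices with a leaving edge would contain a
        path on \<open>k + 1\<close> vertices.\<close>
      have "card C < k"
      proof -
        obtain cs where cs: "path_in (adj E) C cs" "set cs = C" "last cs = x1" "cs \<noteq> []" "length cs = card C"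
          using clique_path[of C x1 E] finC xy1(1) clique by blast
        then have "path_in (adj E) V (cs @ [y1])"
          using path_in_mono[OF cs(1) CV] xy1 by (auto simp: path_in_append path_in_Cons adj_def)
        then have "length (cs @ [y1]) \<le> k" using pf unfolding path_bounded_def by blast
        then show ?thesis using cs(5) by simp
      qed
      define a where "a = k - card C"
      have tC: "t + 2 \<le> card C"
      proof -
        have "nbrs E C x1 \<subseteq> C - {x1}" by (auto simp: nbrs_def)
        then have "card (nbrs E C x1) \<le> card C - 1"
          using card_mono[of "C - {x1}"] finC xy1(1) by (metis card_Diff_singleton finite_Diff)
        then show ?thesis using degC[OF xy1(1)] by linarith
      qed
      have a: "card C + a = k" "a \<le> t" using \<open>card C < k\<close> tC t by (auto simp: a_def)
      \<comment> \<open>The core is taken again with the smaller threshold \<open>a\<close>. It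
        contains \<open>C\<close>, and the aim is that it contains nothing else.\<close>
      obtain L where L: "is_core E a V L" using core_exists[OF assms(1)] by blast
      then have LV: "L \<subseteq> V" and Ldeg: "\<And>x. x \<in> L \<Longrightarrow> a < card (nbrs E L x)"
        and Lmax: "\<And>D. D \<subseteq> V \<Longrightarrow> \<forall>x\<in>D. a < card (nbrs E D x) \<Longrightarrow> D \<subseteq> L"
        by (simp_all add: is_core_def)
      note Lpeel = core_peel[OF assms(1) L r, where c = c]
      have CL: "C \<subseteq> L" using Lmax[OF CV] degC a(2) by fastforce
      have "L = C"
      proof (rule outer_core_eq[OF assms(1) pf maxl conn CL _ CH(2) a(1) clique])
        show "L \<subseteq> V" by (rule LV)
        show "a < card (nbrs E L x)" if "x \<in> L" for x using Ldeg that .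
        show "\<exists>x\<in>C. {x, y} \<notin> E" if y: "y \<in> L - C" for y
        proof (rule ccontr)
          assume "\<not> ?thesis"
          \<comment> \<open>If \<open>y\<close> is adjacent to all of \<open>C\<close>, then
            \<open>C\<close> with \<open>y\<close> has minimum degree above \<open>t\<close>. So
            \<open>y\<close> lies in \<open>H\<close>, and closedness puts it into
            \<open>C\<close>.\<close>
          then have full: "\<And>x. x \<in> C \<Longrightarrow> {x, y} \<in> E" by blast
          have "t < card (nbrs E (insert y C) x)" if "x \<in> insert y C" for x
          proof (cases "x = y")
            case True
            have "C \<subseteq> nbrs E (insert y C) y" using full y by (auto simp: nbrs_def insert_commute)
            then have "card C \<le> card (nbrs E (insert y C) y)" using finC by (intro card_mono) auto
            then show ?thesis using tC True by simp
          next
            case False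
            then have "card (nbrs E C x) \<le> card (nbrs E (insert y C) x)"
              using finC by (intro card_mono) (auto simp: nbrs_def)
            then show ?thesis using degC[of x] that False by auto
          qed
          moreover have "insert y C \<subseteq> V" using CV y LV by auto
          ultimately have "insert y C \<subseteq> H" by (intro Hmax) auto
          then show False using Cclosed[of x1 y] full xy1(1) y by blast
        qed
      qed
      have ka: "2 * a + 1 \<le> k" using a(2) t(1) by linarith
      have cV: "card V = card C + card (V - C)" using CV assms(1) by (simp add: card_Diff_subset finC card_mono)
      show ?thesis
      proof (cases "k \<le> card (V - C)")
        case True
        with \<open>L = C\<close> obtain U where "U \<subseteq> V" "card U + k = card V" "?w V \<le> ?w U + k * vertex_weight r a"
          using Lpeel by blast
        then show ?thesis using peel ka by blast
      next
        case False
        \<comment> \<open>Now \<open>card V\<close> lies between \<open>k\<close> and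
          \<open>2 * k\<close>, and deleting all \<open>a + q\<close> vertices outside
          \<open>C\<close> leaves exactly the clique.\<close>
        define q where "q = card V - k"
        have q: "card (V - C) = a + q" "q < k" "card V = 1 * k + q" using big False cV a(1) by (auto simp: q_def)
        obtain U where U: "U \<subseteq> V" "C \<subseteq> U" "card U + (a + q) = card V" "?w V \<le> ?w U + (a + q) * vertex_weight r a"
          using Lpeel[of "a + q"] \<open>L = C\<close> q(1) by auto
        have "U = C"
          using U cV q(1) assms(1) by (metis add_right_cancel card_subset_eq finite_subset)
        then have "?w V \<le> clique_weight r (k - a) + (a + q) * vertex_weight r a"
          using U(4) graph_weight_le_clique_weight[OF finC r, of E c] a(1) by (metis add_diff_cancel_right' add_le_mono1 le_trans)
        also have "\<dots> \<le> clique_weight r k + clique_weight r q"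
          by (rule core_weight[OF r k ka])
        also have "\<dots> = ?F (card V)"
          unfolding q(3) using path_bound_eq[OF q(2), of r 1] by simp
        finally show ?thesis .
      qed
    qed
  qed
qed

lemma path_bounded_subset: "path_bounded k E V \<Longrightarrow> U \<subseteq> V \<Longrightarrow> path_bounded k E U"
  unfolding path_bounded_def using path_in_mono by blast

text \<open>Outer induction on the number of vertices, inner induction on the number of missing
  pairs. The colouring is generalised because an added edge is coloured red.\<close>

lemma graph_weight_le_path_bound:
  assumes "finite V" "2 \<le> r" "r + 2 \<le> k" "path_bounded k E V"
  shows "graph_weight r E c V \<le> path_bound r k (card V)"
  using assms(1,4)
proof (induction "card V" arbitrary: V E c rule: less_induct)
  case outer: less
  from outer.prems(2) show ?case
  proof (induction "card ([V]\<^bsup>2\<^esup> - E)" arbitrary: E c rule: less_induct)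
    case inner: less
    show ?case
    proof (cases "path_maximal k E V")
      case True
      show ?thesis
      proof (rule graph_weight_le_maximal[OF outer.prems(1) assms(2,3) inner.prems True])
        fix U assume "U \<subset> V"
        then show "graph_weight r E c U \<le> path_bound r k (card U)"
          using outer.hyps[of U E c] outer.prems(1) path_bounded_subset[OF inner.prems, of U]
          by (auto simp: psubset_card_mono finite_subset)
      qed
    next
      case False
      then obtain u v where uv: "u \<in> V" "v \<in> V" "u \<noteq> v" "{u, v} \<notin> E" "path_bounded k (insert {u, v} E) V"
        unfolding path_maximal_def by blast
      have "{u, v} \<in> [V]\<^bsup>2\<^esup>" using uv by simp
      then have "[V]\<^bsup>2\<^esup> - insert {u, v} E \<subset> [V]\<^bsup>2\<^esup> - E"
        using uv(4) by blast
      then have "card ([V]\<^bsup>2\<^esup> - insert {u, v} E) < card ([V]\<^bsup>2\<^esup> - E)"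
        using outer.prems(1) by (intro psubset_card_mono) (auto intro: finite_imp_finite_nsets)
      then have "graph_weight r (insert {u, v} E) (c({u, v} := Red)) V \<le> path_bound r k (card V)"
        using inner.hyps uv(5) by blast
      then show ?thesis
        using graph_weight_add_red[OF outer.prems(1) uv(4), of r c] by linarith
    qed
  qed
qed

section \<open>Copies, and the extremal graph\<close>

text \<open>A copy of a complete graph is determined by its vertex set, as its edges are all the
  pairs.\<close>

lemma copies_complete_graph:
  "copies (complete_graph r) (colour_subgraph G c Blue) = (\<lambda>K. Graph K ([K]\<^bsup>2\<^esup>)) ` blue_cliques r (edges G) c (verts G)"
proof (intro subset_antisym subsetI)
  fix H assume "H \<in> copies (complete_graph r) (colour_subgraph G c Blue)"
  then obtain f where sub: "verts H \<subseteq> verts G" "edges H \<subseteq> {e \<in> edges G. c e = Blue}"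
    and f: "bij_betw f {..<r} (verts H)" "edges H = (\<lambda>e. f ` e) ` ([{..<r}]\<^bsup>2\<^esup>)"
    by (auto simp: copies_def subgraph_def isomorphic_def colour_subgraph_def complete_graph_def)
  have eq: "edges H = [verts H]\<^bsup>2\<^esup>"
    using bij_betw_nsets[OF f(1), of 2] f(2) by (simp add: bij_betw_def)
  have "finite (verts H)" "card (verts H) = r"
    using f(1) bij_betw_finite[OF f(1)] bij_betw_same_card[OF f(1)] by auto
  then have "verts H \<in> blue_cliques r (edges G) c (verts G)"
    using sub eq by (auto simp: blue_cliques_def nsets_def)
  moreover have "H = Graph (verts H) ([verts H]\<^bsup>2\<^esup>)" using eq by (metis graph.collapse)
  ultimately show "H \<in> (\<lambda>K. Graph K ([K]\<^bsup>2\<^esup>)) ` blue_cliques r (edges G) c (verts G)" by blast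
next
  fix H assume "H \<in> (\<lambda>K. Graph K ([K]\<^bsup>2\<^esup>)) ` blue_cliques r (edges G) c (verts G)"
  then obtain K where K: "H = Graph K ([K]\<^bsup>2\<^esup>)" "K \<in> blue_cliques r (edges G) c (verts G)" by blast
  then have "finite K" "card K = r" by (auto simp: blue_cliques_def nsets_def)
  then obtain f where f: "bij_betw f {..<r} K"
    using ex_bij_betw_nat_finite[of K] by (auto simp: atLeast0LessThan)
  then have "[K]\<^bsup>2\<^esup> = (\<lambda>e. f ` e) ` ([{..<r}]\<^bsup>2\<^esup>)"
    using bij_betw_nsets[OF f, of 2] by (simp add: bij_betw_def)
  with f have "isomorphic (complete_graph r) H"
    by (auto simp: isomorphic_def complete_graph_def K(1))
  moreover have "subgraph H (colour_subgraph G c Blue)"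
    using K(2) by (auto simp: subgraph_def colour_subgraph_def K(1) blue_cliques_def nsets_def)
  ultimately show "H \<in> copies (complete_graph r) (colour_subgraph G c Blue)" by (simp add: copies_def)
qed

lemma g_eq_graph_weight:
  assumes "simple_graph G"
  shows "g r G c = graph_weight r (edges G) c (verts G)"
proof -
  have "inj_on (\<lambda>K. Graph K ([K]\<^bsup>2\<^esup>)) A" for A :: "'a set set" by (auto simp: inj_on_def)
  then have "num_copies (complete_graph r) (colour_subgraph G c Blue) = card (blue_cliques r (edges G) c (verts G))"
    by (simp add: num_copies_def copies_complete_graph card_image)
  moreover have "edges (colour_subgraph G c Red) = red_edges (edges G) c (verts G)"
    using assms by (auto simp: colour_subgraph_def red_edges_def simple_graph_def)
  ultimately show ?thesis by (simp add: g_def graph_weight_def)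
qed

lemma path_free_imp_path_bounded:
  assumes "path_free k G"
  shows "path_bounded k (edges G) (verts G)"
  unfolding path_bounded_def
proof (intro allI impI, rule ccontr)
  fix xs assume xs: "path_in (adj (edges G)) (verts G) xs" and "\<not> length xs \<le> k"
  then have len: "k < length xs" by simp
  let ?f = "(!) xs"
  let ?H = "Graph (?f ` {..k}) ((\<lambda>e. ?f ` e) ` edges (path_graph k))"
  have "inj_on ?f {..k}"
    using xs len by (auto simp: path_in_def intro: inj_on_nth)
  then have "isomorphic (path_graph k) ?H"
    unfolding isomorphic_def by (intro exI[of _ ?f]) (auto simp: path_graph_def bij_betw_def)
  moreover have "subgraph ?H G"
  proof -
    have "?f ` {..k} \<subseteq> verts G" using xs len by (auto simp: path_in_def)
    moreover have "{xs ! i, xs ! Suc i} \<in> edges G" if "i < k" for i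
      using xs len that by (auto simp: path_in_def successively_conv_nth adj_def)
    ultimately show ?thesis by (auto simp: subgraph_def path_graph_def)
  qed
  ultimately have "?H \<in> copies (path_graph k) G" by (simp add: copies_def)
  then show False using assms by (simp add: path_free_def)
qed

section \<open>Disjoint cliques attaining the bound\<close>

text \<open>The intervals of length \<open>k\<close> in the natural numbers become cliques. One
  infinite edge set serves every \<open>n\<close> by restriction.\<close>

definition block_edges :: "nat \<Rightarrow> nat set set" where
  "block_edges k = {{x, y} | x y. x \<noteq> y \<and> x div k = y div k}"

lemma block_edges_iff: "{x, y} \<in> block_edges k \<longleftrightarrow> x \<noteq> y \<and> x div k = y div k"
  by (auto simp: block_edges_def doubleton_eq_iff)

text \<open>A path never leaves its block, and a block has only \<open>k\<close> of the
  \<open>k + 1\<close> vertices needed.\<close>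

lemma path_free_blocks:
  assumes "0 < k" "edges G \<subseteq> block_edges k"
  shows "path_free k G"
  unfolding path_free_def
proof (rule ccontr)
  assume "copies (path_graph k) G \<noteq> {}"
  then obtain H f where f: "bij_betw f {..k} (verts H)"
    and "edges H = (\<lambda>e. f ` e) ` {{i, Suc i} | i. i < k}" "edges H \<subseteq> edges G"
    by (auto simp: copies_def isomorphic_def path_graph_def subgraph_def)
  then have edge: "f ` {i, Suc i} \<in> block_edges k" if "i < k" for i
    using assms(2) that by blast
  have block: "f i div k = f 0 div k" if "i \<le> k" for i
    using that
  proof (induction i)
    case (Suc i)
    then show ?case using edge[of i] by (simp add: block_edges_iff)
  qed simp
  have "f ` {..k} \<subseteq> {f 0 div k * k..<f 0 div k * k + k}"
  proof (rule image_subsetI)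
    fix i assume "i \<in> {..k}"
    then have "f i = f 0 div k * k + f i mod k" using block[of i] by (metis atMost_iff div_mult_mod_eq)
    moreover have "f i mod k < k" using assms(1) by simp
    ultimately show "f i \<in> {f 0 div k * k..<f 0 div k * k + k}" by simp
  qed
  then have "card (f ` {..k}) \<le> k"
    using card_mono[of "{f 0 div k * k..<f 0 div k * k + k}"] by fastforce
  moreover have "card (f ` {..k}) = Suc k"
    using f by (metis bij_betw_def card_atMost card_image)
  ultimately show False by simp
qed

lemma graph_weight_blue_clique:
  assumes "finite S" "\<And>e. e \<in> [S]\<^bsup>2\<^esup> \<Longrightarrow> e \<in> E \<and> c e = Blue"
  shows "graph_weight r E c S = card S choose r"
proof -
  have "blue_cliques r E c S = [S]\<^bsup>r\<^esup>"
    using assms(2) by (auto simp: blue_cliques_def nsets_def)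
  moreover have "red_edges E c S = {}" using assms(2) by (auto simp: red_edges_def)
  ultimately show ?thesis using card_nsets_choose[OF assms(1)] by (simp add: graph_weight_def)
qed

lemma graph_weight_red_clique:
  assumes "finite S" "2 \<le> r" "\<And>e. e \<in> [S]\<^bsup>2\<^esup> \<Longrightarrow> e \<in> E \<and> c e = Red"
  shows "graph_weight r E c S = card S choose 2"
proof -
  have "K \<notin> blue_cliques r E c S" for K
  proof
    assume K: "K \<in> blue_cliques r E c S"
    then have "finite K" "card K = r" by (auto simp: blue_cliques_def nsets_def)
    then have "[K]\<^bsup>2\<^esup> \<noteq> {}" using assms(2) by (simp add: nsets_eq_empty_iff)
    then obtain e where "e \<in> [K]\<^bsup>2\<^esup>" by blast
    moreover from this have "e \<in> [S]\<^bsup>2\<^esup>" using K by (auto simp: blue_cliques_def nsets_def)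
    ultimately show False using K assms(3)[of e] by (auto simp: blue_cliques_def)
  qed
  then have "blue_cliques r E c S = {}" by blast
  moreover have "red_edges E c S = [S]\<^bsup>2\<^esup>" using assms(3) by (auto simp: red_edges_def)
  ultimately show ?thesis using card_nsets_choose[OF assms(1)] by (simp add: graph_weight_def)
qed

lemma block_pairs:
  assumes "e \<in> [{j * k..<j * k + m}]\<^bsup>2\<^esup>" "m \<le> k"
  shows "e \<in> block_edges k"
proof -
  have div: "x div k = j" if "x \<in> {j * k..<j * k + m}" for x
    using that assms(2) by (intro div_nat_eqI) (auto simp: algebra_simps)
  obtain x y where "e = {x, y}" "x \<in> {j * k..<j * k + m}" "y \<in> {j * k..<j * k + m}" "x \<noteq> y"
    using assms(1) by (rule nsets2_E)
  then show ?thesis using div[of x] div[of y] by (simp add: block_edges_iff)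
qed

lemma block_colouring_weight:
  assumes "2 \<le> r" "0 < k" "q < k"
  shows "\<exists>c. graph_weight r (block_edges k) c {..<p * k + q} = p * (k choose r) + clique_weight r q"
proof -
  \<comment> \<open>Full blocks are blue; the last block takes the colour that is better for its
    size \<open>q\<close>.\<close>
  define c where "c e = (if r + 2 \<le> q \<or> e \<subseteq> {..<p * k} then Blue else Red)" for e :: "nat set"
  let ?w = "graph_weight r (block_edges k) c"
  have add: "?w {..<j * k + m} = ?w {..<j * k} + ?w {j * k..<j * k + m}" for j m
  proof -
    have "{..<j * k + m} = {..<j * k} \<union> {j * k..<j * k + m}" by auto
    moreover have "{x, y} \<notin> block_edges k" if "x \<in> {..<j * k}" "y \<in> {j * k..<j * k + m}" for x y
    proof -
      have "x div k < j" using that(1) assms(2) by (simp add: less_mult_imp_div_less)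
      moreover have "j \<le> y div k" using that(2) assms(2) by (simp add: less_eq_div_iff_mult_less_eq)
      ultimately show ?thesis by (simp add: block_edges_iff)
    qed
    ultimately show ?thesis
      using graph_weight_Un[of "{..<j * k}" "{j * k..<j * k + m}" r "block_edges k" c] assms(1) by fastforce
  qed
  have "?w {..<j * k} = j * (k choose r)" if "j \<le> p" for j
    using that
  proof (induction j)
    case 0
    show ?case
      using graph_weight_blue_clique[of "{}" "block_edges k" c r] assms(1) by (simp add: nsets_empty_iff binomial_eq_0)
  next
    case (Suc j)
    have "j * k + k \<le> p * k" using mult_le_mono1[OF Suc.prems, of k] by simp
    then have "c e = Blue" if "e \<in> [{j * k..<j * k + k}]\<^bsup>2\<^esup>" for e
      using that by (auto simp: c_def elim!: nsets2_E)
    then have "?w {j * k..<j * k + k} = k choose r"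
      using graph_weight_blue_clique[of "{j * k..<j * k + k}" "block_edges k" c r] block_pairs[of _ j k k]
      by simp
    then show ?case using add[of j k] Suc by (simp add: add.commute)
  qed
  moreover have "?w {p * k..<p * k + q} = clique_weight r q"
  proof (cases "r + 2 \<le> q")
    case True
    then show ?thesis
      using graph_weight_blue_clique[of "{p * k..<p * k + q}" "block_edges k" c r] block_pairs[of _ p k q] assms(3)
      by (simp add: c_def clique_weight_def)
  next
    case False
    have "c e = Red" if "e \<in> [{p * k..<p * k + q}]\<^bsup>2\<^esup>" for e
      using that False by (auto simp: c_def elim!: nsets2_E)
    then show ?thesis
      using graph_weight_red_clique[of "{p * k..<p * k + q}" r "block_edges k" c] block_pairs[of _ p k q] assms False
      by (simp add: clique_weight_def)
  qed
  ultimately show ?thesis using add[of p q] by (intro exI[of _ c]) simp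
qed

lemma graph_weight_restrict: "graph_weight r (E \<inter> [V]\<^bsup>2\<^esup>) c V = graph_weight r E c V"
proof -
  have "[K]\<^bsup>2\<^esup> \<subseteq> [V]\<^bsup>2\<^esup>" if "K \<in> [V]\<^bsup>r\<^esup>" for K
    using that by (intro nsets_mono) (auto simp: nsets_def)
  then have "blue_cliques r (E \<inter> [V]\<^bsup>2\<^esup>) c V = blue_cliques r E c V"
    unfolding blue_cliques_def by blast
  moreover have "red_edges (E \<inter> [V]\<^bsup>2\<^esup>) c V = red_edges E c V" by (auto simp: red_edges_def)
  ultimately show ?thesis by (simp add: graph_weight_def)
qed

theorem theorem3p4:
  fixes r k n p q :: nat
  assumes "r \<ge> 2" and "k \<ge> r + 2" and "n = p * k + q" and "q < k"
  shows "(\<forall>(G :: 'a graph) c. simple_graph G \<and> card (verts G) = n \<and> path_free k G \<longrightarrow>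
            g r G c \<le> p * (k choose r) + (if q \<ge> r + 2 then q choose r else q choose 2))
       \<and> (\<exists>(G :: nat graph) c. simple_graph G \<and> card (verts G) = n \<and> path_free k G \<and>
            g r G c = p * (k choose r) + (if q \<ge> r + 2 then q choose r else q choose 2))"
proof (intro conjI allI impI)
  fix G :: "'a graph" and c
  assume G: "simple_graph G \<and> card (verts G) = n \<and> path_free k G"
  then have "graph_weight r (edges G) c (verts G) \<le> path_bound r k n"
    using graph_weight_le_path_bound[of "verts G" r k "edges G" c] path_free_imp_path_bounded[of k G] assms(1,2)
    by (simp add: simple_graph_def)
  moreover have "path_bound r k n = p * (k choose r) + (if q \<ge> r + 2 then q choose r else q choose 2)"
    using path_bound_eq[OF assms(4), of r p] assms(2,3) by (simp add: clique_weight_def)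
  ultimately show "g r G c \<le> p * (k choose r) + (if q \<ge> r + 2 then q choose r else q choose 2)"
    using g_eq_graph_weight[of G r c] G by simp
next
  obtain c where c: "graph_weight r (block_edges k) c {..<n} = p * (k choose r) + clique_weight r q"
    using block_colouring_weight[of r k q p] assms by auto
  define G where "G = Graph {..<n} (block_edges k \<inter> [{..<n}]\<^bsup>2\<^esup>)"
  have simple: "simple_graph G" by (simp add: G_def simple_graph_def)
  moreover have "path_free k G"
    using path_free_blocks[of k G] assms(2) by (simp add: G_def)
  moreover have "g r G c = p * (k choose r) + (if q \<ge> r + 2 then q choose r else q choose 2)"
    using g_eq_graph_weight[OF simple, of r c] c by (simp add: G_def graph_weight_restrict clique_weight_def)
  ultimately show "\<exists>(G :: nat graph) c. simple_graph G \<and> card (verts G) = n \<and> path_free k G \<and>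
            g r G c = p * (k choose r) + (if q \<ge> r + 2 then q choose r else q choose 2)"
    by (intro exI[of _ G] exI[of _ c]) (simp add: G_def)
qed

end
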